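(* There exists an absolute constant $c>0$ such that the following holds. Let $K$ be a symmetric convex body in $\mathbb{R}^n$ containing the unit Euclidean ball $B_2^n$, and let $M=c\,M_K\log^{-3/2}(2/M_K)$. Then there exists a subset $\sigma$ of $\{1,\dots,n\}$ of size $|\sigma|\ge M^2n$ such that $$M\,(K\cap\mathbb{R}^\sigma)\subseteq\sqrt{|\sigma|}\,B_1^\sigma .$$
   Context: A convex body $K$ is symmetric if $K=-K$. $\|\cdot\|_K$ denotes the Minkowski functional of $K$, and $M_K=\int_{S^{n-1}}\|x\|_K\,d\sigma(x)$, the integral being with respect to the normalized Lebesgue (rotation invariant probability) measure on the unit Euclidean sphere $S^{n-1}$. For $\sigma\subseteq\{1,\dots,n\}$, $\mathbb{R}^\sigma$ is the coordinate subspace of vectors in $\mathbb{R}^n$ supported in $\sigma$, and $B_1^\sigma=\{x\in\mathbb{R}^\sigma:\sum_{i\in\sigma}|x_i|\le1\}$. *)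

theory Defs
  imports "HOL-Probability.Probability_Measure" "HOL-Library.Function_Algebras"
begin

text \<open>
  The constant in the theorem is independent of the dimension, so the dimension has to be a
  natural number rather than a type. The space \<open>\<real>\<^sup>n\<close> is represented by the real sequences
  supported in \<open>{1..n}\<close>. The library's (product) topology on \<open>nat \<Rightarrow> real\<close> induces the usual
  topology on this subspace; the linear structure is the pointwise one.
\<close>

instantiation "fun" :: (type, real_vector) real_vector
begin

definition scaleR_fun :: "real \<Rightarrow> ('a \<Rightarrow> 'b) \<Rightarrow> 'a \<Rightarrow> 'b"
  where "scaleR_fun r f = (\<lambda>x. r *\<^sub>R f x)"

instance
  by standard (simp_all add: scaleR_fun_def fun_eq_iff scaleR_add_right scaleR_add_left)

end

lemma scaleR_fun_apply [simp]: "(r *\<^sub>R f) x = r *\<^sub>R f x"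
  by (simp add: scaleR_fun_def)

definition coord_space :: "nat set \<Rightarrow> (nat \<Rightarrow> real) set"
  where "coord_space \<sigma> = {x. \<forall>i. i \<notin> \<sigma> \<longrightarrow> x i = 0}"

abbreviation Rn :: "nat \<Rightarrow> (nat \<Rightarrow> real) set"
  where "Rn n \<equiv> coord_space {1..n}"

definition l1_ball :: "nat set \<Rightarrow> (nat \<Rightarrow> real) set"
  where "l1_ball \<sigma> = {x \<in> coord_space \<sigma>. (\<Sum>i\<in>\<sigma>. \<bar>x i\<bar>) \<le> 1}"

definition l2_norm :: "nat \<Rightarrow> (nat \<Rightarrow> real) \<Rightarrow> real"
  where "l2_norm n x = L2_set x {1..n}"

definition l2_ball :: "nat \<Rightarrow> (nat \<Rightarrow> real) set"
  where "l2_ball n = {x \<in> Rn n. l2_norm n x \<le> 1}"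

definition l2_sphere :: "nat \<Rightarrow> (nat \<Rightarrow> real) set"
  where "l2_sphere n = {x \<in> Rn n. l2_norm n x = 1}"

definition convex_body :: "nat \<Rightarrow> (nat \<Rightarrow> real) set \<Rightarrow> bool"
  where "convex_body n K \<longleftrightarrow>
    K \<subseteq> Rn n \<and> convex K \<and> compact K \<and> top_of_set (Rn n) interior_of K \<noteq> {}"

definition symmetric :: "(nat \<Rightarrow> real) set \<Rightarrow> bool"
  where "symmetric K \<longleftrightarrow> K = uminus ` K"

definition minkowski_functional :: "(nat \<Rightarrow> real) set \<Rightarrow> (nat \<Rightarrow> real) \<Rightarrow> real"
  where "minkowski_functional K x = Inf {t. 0 < t \<and> x \<in> (*\<^sub>R) t ` K}"

text \<open>
  \<open>PiM {1..n} (\<lambda>_. lborel)\<close> lives on functions that are \<open>undefined\<close> outside \<open>{1..n}\<close>; the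
  image measure replaces this value by \<open>0\<close>.
\<close>

definition zero_extend :: "nat \<Rightarrow> (nat \<Rightarrow> real) \<Rightarrow> nat \<Rightarrow> real"
  where "zero_extend n x = (\<lambda>i. if i \<in> {1..n} then x i else 0)"

definition lborel_Rn :: "nat \<Rightarrow> (nat \<Rightarrow> real) measure"
  where "lborel_Rn n =
    distr (PiM {1..n} (\<lambda>_. lborel)) (restrict_space borel (Rn n)) (zero_extend n)"

text \<open>
  The normalized Lebesgue measure on the sphere: the radial projection of the uniform
  distribution on the (punctured) Euclidean ball. That it is a rotation invariant probability
  measure is proved below.
\<close>

definition punctured_ball :: "nat \<Rightarrow> (nat \<Rightarrow> real) set"
  where "punctured_ball n = l2_ball n - {0}"

definition sphere_measure :: "nat \<Rightarrow> (nat \<Rightarrow> real) measure"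
  where "sphere_measure n =
    distr (uniform_measure (restrict_space (lborel_Rn n) (punctured_ball n)) (punctured_ball n))
      (restrict_space borel (l2_sphere n)) (\<lambda>x. x /\<^sub>R l2_norm n x)"

definition mean_norm :: "nat \<Rightarrow> (nat \<Rightarrow> real) set \<Rightarrow> real"
  where "mean_norm n K = (\<integral>x. minkowski_functional K x \<partial>sphere_measure n)"


subsection \<open>Rotation invariance of the sphere measure\<close>

lemma l2_norm_eq_0_iff: "x \<in> Rn n \<Longrightarrow> l2_norm n x = 0 \<longleftrightarrow> x = 0"
  by (auto simp: l2_norm_def L2_set_eq_0_iff coord_space_def fun_eq_iff)

lemma l2_norm_nonneg [simp]: "0 \<le> l2_norm n x"
  by (simp add: l2_norm_def)

lemma l2_norm_scaleR: "l2_norm n (r *\<^sub>R x) = \<bar>r\<bar> * l2_norm n x"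
  by (simp add: l2_norm_def L2_set_def power_mult_distrib flip: sum_distrib_left)
     (simp add: real_sqrt_mult)

lemma l2_norm_minus_commute: "l2_norm n (x - y) = l2_norm n (y - x)"
  by (simp add: l2_norm_def L2_set_def power2_commute)

lemma measurable_coordinate_borel [measurable]:
  "(\<lambda>x :: nat \<Rightarrow> real. x i) \<in> borel_measurable borel"
  by (intro borel_measurable_continuous_onI) simp

lemma measurable_l2_norm [measurable]: "l2_norm n \<in> borel_measurable borel"
  unfolding l2_norm_def [abs_def] L2_set_def by measurable

lemma sets_Rn [measurable]: "Rn n \<in> sets borel"
proof -
  have "Rn n = (\<Inter>i. {x \<in> space borel. i \<notin> {1..n} \<longrightarrow> x i = 0})"
    by (auto simp: coord_space_def)
  also have "\<dots> \<in> sets borel" by measurable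
  finally show ?thesis .
qed

lemma sets_l2_ball [measurable]: "l2_ball n \<in> sets borel"
proof -
  have "l2_ball n = Rn n \<inter> {x \<in> space borel. l2_norm n x \<le> 1}" by (auto simp: l2_ball_def)
  also have "\<dots> \<in> sets borel" by measurable
  finally show ?thesis .
qed

lemma sets_l2_ball_Rn: "l2_ball n \<in> sets (restrict_space borel (Rn n))"
proof -
  have "l2_ball n \<subseteq> Rn n" by (auto simp: l2_ball_def)
  then show ?thesis using sets_l2_ball sets_Rn by (subst sets_restrict_space_iff) auto
qed

lemma sets_punctured_ball: "punctured_ball n \<in> sets borel"
proof -
  have "punctured_ball n = l2_ball n \<inter> {x \<in> space borel. l2_norm n x \<noteq> 0}"
    by (auto simp: punctured_ball_def l2_ball_def l2_norm_eq_0_iff)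
  also have "\<dots> \<in> sets borel" by measurable
  finally show ?thesis .
qed

lemma sets_l2_sphere: "l2_sphere n \<in> sets borel"
proof -
  have "l2_sphere n = Rn n \<inter> {x \<in> space borel. l2_norm n x = 1}" by (auto simp: l2_sphere_def)
  also have "\<dots> \<in> sets borel" by measurable
  finally show ?thesis .
qed

lemma space_lborel_Rn [simp]: "space (lborel_Rn n) = Rn n"
  by (simp add: lborel_Rn_def space_restrict_space)

lemma sets_lborel_Rn: "sets (lborel_Rn n) = sets (restrict_space borel (Rn n))"
  by (simp add: lborel_Rn_def)

lemma measurable_into_Rn:
  assumes "\<And>x. x \<in> space M \<Longrightarrow> f x \<in> Rn n"
    and "\<And>i. i \<in> {1..n} \<Longrightarrow> (\<lambda>x. f x i) \<in> borel_measurable M"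
  shows "f \<in> measurable M (lborel_Rn n)"
proof -
  have "(\<lambda>x. f x i) \<in> borel_measurable M" for i
  proof (cases "i \<in> {1..n}")
    case False
    have "(\<lambda>x. f x i) \<in> borel_measurable M \<longleftrightarrow> (\<lambda>x. 0 :: real) \<in> borel_measurable M"
      using assms(1) False by (intro measurable_cong) (auto simp: coord_space_def)
    then show ?thesis by simp
  qed (use assms(2) in auto)
  then have "f \<in> borel_measurable M" by (rule measurable_coordinatewise_then_product)
  then have "f \<in> measurable M (restrict_space borel (Rn n))"
    using assms(1) by (intro measurable_restrict_space2) auto
  then show ?thesis by (simp cong: measurable_cong_sets add: sets_lborel_Rn)
qed

lemma measurable_coordinate [measurable]: "(\<lambda>x. x i) \<in> borel_measurable (lborel_Rn n)"
  using measurable_restrict_space1 [OF measurable_coordinate_borel [of i], of "Rn n"]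
  by (simp cong: measurable_cong_sets add: sets_lborel_Rn)

lemma measurable_zero_extend:
  "zero_extend n \<in> measurable (PiM {1..n} (\<lambda>_. lborel)) (restrict_space borel (Rn n))"
proof -
  have "zero_extend n \<in> measurable (PiM {1..n} (\<lambda>_. lborel)) (lborel_Rn n)"
  proof (rule measurable_into_Rn)
    fix i assume i: "i \<in> {1..n}"
    then have "(\<lambda>x. x i) \<in> measurable (PiM {1..n} (\<lambda>_. lborel)) (lborel :: real measure)"
      by (rule measurable_component_singleton)
    with i show "(\<lambda>x. zero_extend n x i) \<in> borel_measurable (PiM {1..n} (\<lambda>_. lborel))"
      by (simp add: zero_extend_def)
  qed (auto simp: zero_extend_def coord_space_def)
  then show ?thesis by (simp cong: measurable_cong_sets add: sets_lborel_Rn)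
qed

lemma measurable_restrict_Rn:
  "(\<lambda>x. restrict x {1..n}) \<in> measurable (lborel_Rn n) (PiM {1..n} (\<lambda>_. lborel))"
  by (rule measurable_restrict) simp

lemma distr_lborel_Rn_restrict:
  "distr (lborel_Rn n) (PiM {1..n} (\<lambda>_. lborel)) (\<lambda>x. restrict x {1..n})
    = PiM {1..n} (\<lambda>_. lborel)"
proof -
  have "distr (lborel_Rn n) (PiM {1..n} (\<lambda>_. lborel)) (\<lambda>x. restrict x {1..n})
    = distr (PiM {1..n} (\<lambda>_. lborel)) (PiM {1..n} (\<lambda>_. lborel)) (\<lambda>x. x)"
    unfolding lborel_Rn_def
  proof (subst distr_distr [OF _ measurable_zero_extend])
    show "(\<lambda>x. restrict x {1..n}) \<in>
      measurable (restrict_space borel (Rn n)) (PiM {1..n} (\<lambda>_. lborel))"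
      using measurable_restrict_Rn [of n] by (simp cong: measurable_cong_sets add: sets_lborel_Rn)
    show "distr (PiM {1..n} (\<lambda>_. lborel)) (PiM {1..n} (\<lambda>_. lborel))
        ((\<lambda>x. restrict x {1..n}) \<circ> zero_extend n) =
      distr (PiM {1..n} (\<lambda>_. lborel)) (PiM {1..n} (\<lambda>_. lborel)) (\<lambda>x. x)"
      by (intro distr_cong)
         (auto simp: zero_extend_def space_PiM fun_eq_iff PiE_def extensional_def)
  qed
  then show ?thesis by (simp add: distr_id2)
qed

lemma sigma_finite_lborel_Rn: "sigma_finite_measure (lborel_Rn n)"
proof (rule sigma_finite_measure_distr)
  interpret finite_product_sigma_finite "\<lambda>_. lborel :: real measure" "{1..n}" by standard simp
  show "sigma_finite_measure (distr (lborel_Rn n) (PiM {1..n} (\<lambda>_. lborel)) (\<lambda>x. restrict x {1..n}))"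
    unfolding distr_lborel_Rn_restrict by (rule sigma_finite_measure_axioms)
qed (rule measurable_restrict_Rn)

lemma emeasure_l2_ball: "emeasure (lborel_Rn n) (l2_ball n) = ennreal (unit_ball_vol (real n))"
proof -
  have "zero_extend n -` l2_ball n \<inter> space (PiM {1..n} (\<lambda>_. lborel)) =
    {f. sqrt (\<Sum>i\<in>{1..n}. (f i)\<^sup>2) \<le> 1} \<inter> space (PiM {1..n} (\<lambda>_. lborel))"
    by (auto simp: l2_ball_def l2_norm_def L2_set_def zero_extend_def coord_space_def)
  moreover have "l2_ball n \<in> sets (restrict_space borel (Rn n))"
    by (rule sets_l2_ball_Rn)
  ultimately show ?thesis
    using emeasure_cball_aux [of "{1..n}" 1] unfolding lborel_Rn_def
    by (subst emeasure_distr [OF measurable_zero_extend]) simp_all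
qed

lemma lborel_Rn_translation:
  assumes "v \<in> Rn n"
  shows "distr (lborel_Rn n) (lborel_Rn n) (\<lambda>x. x + v) = lborel_Rn n"
proof -
  interpret product_sigma_finite "\<lambda>_ :: nat. lborel :: real measure" by standard
  let ?P = "PiM {1..n} (\<lambda>_. lborel :: real measure)"
  let ?t = "\<lambda>x. \<lambda>i\<in>{1..n}. x i + v i"
  have t: "?t \<in> measurable ?P ?P" by (rule measurable_restrict) measurable
  have P: "distr ?P ?P ?t = ?P"
  proof (rule PiM_eqI)
    fix A :: "nat \<Rightarrow> real set" assume A: "\<And>i. i \<in> {1..n} \<Longrightarrow> A i \<in> sets lborel"
    have "?t -` Pi\<^sub>E {1..n} A \<inter> space ?P = Pi\<^sub>E {1..n} (\<lambda>i. (\<lambda>y. y + v i) -` A i)"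
      by (auto simp: space_PiM PiE_def Pi_def)
    moreover have "(\<lambda>y. y + v i) -` A i \<in> sets lborel" if "i \<in> {1..n}" for i
      using measurable_sets [of "\<lambda>y. y + v i" borel borel "A i"] A [OF that] by simp
    moreover have "emeasure lborel ((\<lambda>y. y + v i) -` A i) = emeasure lborel (A i)"
      if "i \<in> {1..n}" for i
    proof -
      have "emeasure lborel (A i) = emeasure (distr lborel borel ((+) (v i))) (A i)"
        by (simp add: lborel_distr_plus)
      also have "\<dots> = emeasure lborel ((\<lambda>y. y + v i) -` A i)"
        using A [OF that] by (subst emeasure_distr) (auto simp: vimage_def add.commute)
      finally show ?thesis by simp
    qed
    ultimately have "emeasure ?P (?t -` Pi\<^sub>E {1..n} A \<inter> space ?P)
      = (\<Prod>i\<in>{1..n}. emeasure lborel (A i))"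
      using emeasure_PiM [of "{1..n}" "\<lambda>i. (\<lambda>y. y + v i) -` A i"] by simp
    moreover have "Pi\<^sub>E {1..n} A \<in> sets ?P" using A by (intro sets_PiM_I_finite) auto
    ultimately show "emeasure (distr ?P ?P ?t) (Pi\<^sub>E {1..n} A) = (\<Prod>i\<in>{1..n}. emeasure lborel (A i))"
      using t by (simp add: emeasure_distr)
  qed simp_all
  have z: "zero_extend n \<in> measurable ?P (lborel_Rn n)"
    using measurable_zero_extend by (simp cong: measurable_cong_sets add: sets_lborel_Rn)
  have L: "lborel_Rn n = distr ?P (lborel_Rn n) (zero_extend n)"
    unfolding lborel_Rn_def by (intro distr_cong) simp_all
  have m: "(\<lambda>x. x + v) \<in> measurable (lborel_Rn n) (lborel_Rn n)"
    using assms by (intro measurable_into_Rn) (auto simp: coord_space_def)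
  have "distr (lborel_Rn n) (lborel_Rn n) (\<lambda>x. x + v)
    = distr ?P (lborel_Rn n) (\<lambda>x. zero_extend n x + v)"
    by (subst L, subst distr_distr [OF m z]) (simp add: comp_def)
  also have "\<dots> = distr ?P (lborel_Rn n) (\<lambda>x. zero_extend n (?t x))"
    using assms by (intro distr_cong) (auto simp: zero_extend_def coord_space_def fun_eq_iff)
  also have "\<dots> = distr (distr ?P ?P ?t) (lborel_Rn n) (zero_extend n)"
    by (subst distr_distr [OF z t]) (simp add: comp_def)
  also have "\<dots> = lborel_Rn n" using L P by simp
  finally show ?thesis .
qed

text \<open>The linear isometries of \<open>\<real>\<^sup>n\<close>; the values outside \<open>\<real>\<^sup>n\<close> are irrelevant.\<close>

definition rotation :: "nat \<Rightarrow> ((nat \<Rightarrow> real) \<Rightarrow> nat \<Rightarrow> real) \<Rightarrow> bool"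
  where "rotation n T \<longleftrightarrow> T ` Rn n = Rn n \<and>
    (\<forall>x\<in>Rn n. \<forall>y\<in>Rn n. T (x + y) = T x + T y) \<and>
    (\<forall>r. \<forall>x\<in>Rn n. T (r *\<^sub>R x) = r *\<^sub>R T x) \<and>
    (\<forall>x\<in>Rn n. l2_norm n (T x) = l2_norm n x)"

lemma coord_space_closed:
  "0 \<in> coord_space \<sigma>"
  "x \<in> coord_space \<sigma> \<Longrightarrow> y \<in> coord_space \<sigma> \<Longrightarrow> x + y \<in> coord_space \<sigma>"
  "x \<in> coord_space \<sigma> \<Longrightarrow> y \<in> coord_space \<sigma> \<Longrightarrow> x - y \<in> coord_space \<sigma>"
  "x \<in> coord_space \<sigma> \<Longrightarrow> r *\<^sub>R x \<in> coord_space \<sigma>"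
  by (auto simp: coord_space_def)

lemma rotation_measurable:
  assumes "rotation n T"
  shows "T \<in> measurable (lborel_Rn n) (lborel_Rn n)"
proof (rule measurable_into_Rn)
  define e :: "nat \<Rightarrow> nat \<Rightarrow> real" where "e i = (\<lambda>j. if j = i then 1 else 0)" for i
  have e: "e i \<in> Rn n" if "i \<in> {1..n}" for i using that by (auto simp: e_def coord_space_def)
  have add: "T (x + y) = T x + T y" if "x \<in> Rn n" "y \<in> Rn n" for x y
    using assms that by (auto simp: rotation_def)
  have scale: "T (r *\<^sub>R x) = r *\<^sub>R T x" if "x \<in> Rn n" for r x
    using assms that by (auto simp: rotation_def)
  have sum: "S \<in> Rn n \<and> T S = S'"
    if "A \<subseteq> {1..n}" "S = (\<Sum>i\<in>A. x i *\<^sub>R e i)" "S' = (\<Sum>i\<in>A. x i *\<^sub>R T (e i))"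
    for x :: "nat \<Rightarrow> real" and A S S'
  proof -
    from that(1) have "finite A" by (rule finite_subset) simp
    then show ?thesis using that
    proof (induction A arbitrary: S S')
      case empty
      have "T 0 = 0" using scale [of 0 0] by (simp add: coord_space_closed(1))
      then show ?case using coord_space_closed(1) unfolding empty.prems(2,3) sum.empty by blast
    next
      case (insert i A)
      let ?u = "x i *\<^sub>R e i" and ?v = "\<Sum>i\<in>A. x i *\<^sub>R e i"
      have v: "?v \<in> Rn n" "T ?v = (\<Sum>i\<in>A. x i *\<^sub>R T (e i))"
        using insert.IH [OF _ refl refl] insert.prems(1) by blast+
      have "e i \<in> Rn n" using insert.prems(1) by (intro e) auto
      then have u: "?u \<in> Rn n" "T ?u = x i *\<^sub>R T (e i)" by (rule coord_space_closed, rule scale)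
      have S: "S = ?u + ?v" "S' = x i *\<^sub>R T (e i) + (\<Sum>i\<in>A. x i *\<^sub>R T (e i))"
        unfolding insert.prems(2,3) sum.insert [OF insert.hyps] by (rule refl)+
      then show ?case
        using coord_space_closed(2) [OF u(1) v(1)] add [OF u(1) v(1)] unfolding S u(2) v(2) by blast
    qed
  qed
  have expand: "(\<Sum>i\<in>{1..n}. x i *\<^sub>R e i) = x" if "x \<in> Rn n" for x
  proof
    fix j
    have apply_sum: "(\<Sum>i\<in>A. f i) j = (\<Sum>i\<in>A. f i j)" if "finite A"
      for f :: "nat \<Rightarrow> nat \<Rightarrow> real" and A :: "nat set"
      using that by induction auto
    show "(\<Sum>i\<in>{1..n}. x i *\<^sub>R e i) j = x j"
      using that by (auto simp: apply_sum e_def coord_space_def if_distrib [of "(*) _"] cong: if_cong)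
  qed
  fix j
  have apply_sum: "(\<Sum>i\<in>A. f i) j = (\<Sum>i\<in>A. f i j)" if "finite A"
    for f :: "nat \<Rightarrow> nat \<Rightarrow> real" and A :: "nat set"
    using that by induction auto
  have "T x j = (\<Sum>i\<in>{1..n}. x i * T (e i) j)" if "x \<in> Rn n" for x :: "nat \<Rightarrow> real"
  proof -
    have "T x = T (\<Sum>i\<in>{1..n}. x i *\<^sub>R e i)" unfolding expand [OF that] ..
    also have "\<dots> = (\<Sum>i\<in>{1..n}. x i *\<^sub>R T (e i))" using sum [OF order_refl refl refl, of x] ..
    finally show ?thesis by (simp add: apply_sum)
  qed
  then have "(\<lambda>x. T x j) \<in> borel_measurable (lborel_Rn n) \<longleftrightarrow>
    (\<lambda>x. \<Sum>i\<in>{1..n}. x i * T (e i) j) \<in> borel_measurable (lborel_Rn n)"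
    by (intro measurable_cong) simp
  then show "(\<lambda>x. T x j) \<in> borel_measurable (lborel_Rn n)" by simp
qed (use assms in \<open>auto simp: rotation_def\<close>)

lemma rotation_diff:
  assumes "rotation n T" "x \<in> Rn n" "y \<in> Rn n"
  shows "T (x - y) = T x - T y"
proof -
  have "T (x + (-1) *\<^sub>R y) = T x + (-1) *\<^sub>R T y"
    using assms coord_space_closed(4) [of y "{1..n}" "-1"] unfolding rotation_def by metis
  moreover have "x + (-1) *\<^sub>R y = x - y" "T x + (-1) *\<^sub>R T y = T x - T y"
    by (simp_all add: fun_eq_iff)
  ultimately show ?thesis by simp
qed

text \<open>
  Lebesgue measure is invariant under rotations: its image under \<open>T\<close> is translation invariant,
  hence proportional to it, and both agree on the ball.
\<close>

lemma lborel_Rn_rotation: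
  assumes T: "rotation n T"
  shows "distr (lborel_Rn n) (lborel_Rn n) T = lborel_Rn n"
proof (rule measure_eqI)
  let ?L = "lborel_Rn n"
  interpret sigma_finite_measure ?L by (rule sigma_finite_lborel_Rn)
  interpret pair_sigma_finite ?L ?L ..
  note Tm [measurable] = rotation_measurable [OF T]
  fix A assume "A \<in> sets (distr ?L ?L T)"
  then have A [measurable]: "A \<in> sets ?L" by simp
  define f g :: "(nat \<Rightarrow> real) \<Rightarrow> ennreal" where "f = indicator A" and "g = indicator (l2_ball n)"
  have B [measurable]: "l2_ball n \<in> sets ?L"
    using sets_l2_ball_Rn by (simp add: sets_lborel_Rn)
  have [measurable]: "f \<in> borel_measurable ?L" "g \<in> borel_measurable ?L"
    by (simp_all add: f_def g_def)
  have add [measurable]: "(\<lambda>(x, y). T x + y) \<in> measurable (?L \<Otimes>\<^sub>M ?L) ?L"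
  proof (rule measurable_into_Rn)
    show "(case p of (x, y) \<Rightarrow> T x + y) \<in> Rn n" if "p \<in> space (?L \<Otimes>\<^sub>M ?L)" for p
      using that T by (auto simp: space_pair_measure rotation_def intro!: coord_space_closed)
    show "(\<lambda>p. (case p of (x, y) \<Rightarrow> T x + y) i) \<in> borel_measurable (?L \<Otimes>\<^sub>M ?L)" for i
      by (simp add: case_prod_beta)
  qed
  have sub [measurable]: "(\<lambda>(x, y). y - T x) \<in> measurable (?L \<Otimes>\<^sub>M ?L) ?L"
  proof (rule measurable_into_Rn)
    show "(case p of (x, y) \<Rightarrow> y - T x) \<in> Rn n" if "p \<in> space (?L \<Otimes>\<^sub>M ?L)" for p
      using that T by (auto simp: space_pair_measure rotation_def intro!: coord_space_closed)
    show "(\<lambda>p. (case p of (x, y) \<Rightarrow> y - T x) i) \<in> borel_measurable (?L \<Otimes>\<^sub>M ?L)" for i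
      by (simp add: case_prod_beta)
  qed
  have trans: "(\<integral>\<^sup>+x. h (x + v) \<partial>?L) = (\<integral>\<^sup>+x. h x \<partial>?L)"
    if "v \<in> Rn n" "h \<in> borel_measurable ?L" for v and h :: "(nat \<Rightarrow> real) \<Rightarrow> ennreal"
  proof -
    have "(\<lambda>x. x + v) \<in> measurable ?L ?L"
      using that(1) by (intro measurable_into_Rn) (auto simp: coord_space_def)
    then have "(\<integral>\<^sup>+x. h x \<partial>distr ?L ?L (\<lambda>x. x + v)) = (\<integral>\<^sup>+x. h (x + v) \<partial>?L)"
      using that(2) by (intro nn_integral_distr) simp_all
    then show ?thesis by (simp add: lborel_Rn_translation [OF that(1)])
  qed
  have preimage: "\<exists>w\<in>Rn n. y = T w" if "y \<in> Rn n" for y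
    using T that unfolding rotation_def by blast
  have TR: "T x \<in> Rn n" if "x \<in> Rn n" for x
    using T that unfolding rotation_def by blast

  have "(\<integral>\<^sup>+x. f (T x) \<partial>?L) * (\<integral>\<^sup>+y. g y \<partial>?L)
    = (\<integral>\<^sup>+y. (\<integral>\<^sup>+x. f (T x) * g y \<partial>?L) \<partial>?L)"
    by (simp add: nn_integral_multc nn_integral_cmult)
  also have "\<dots> = (\<integral>\<^sup>+y. (\<integral>\<^sup>+x. f (T x + y) * g y \<partial>?L) \<partial>?L)"
  proof (rule nn_integral_cong)
    fix y assume "y \<in> space ?L"
    then obtain w where w: "w \<in> Rn n" "y = T w" using preimage by auto
    have "(\<integral>\<^sup>+x. f (T x) * g y \<partial>?L) = (\<integral>\<^sup>+x. f (T (x + w)) * g y \<partial>?L)"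
      by (rule trans [OF w(1), symmetric]) measurable
    also have "\<dots> = (\<integral>\<^sup>+x. f (T x + y) * g y \<partial>?L)"
      using T w by (intro nn_integral_cong) (simp add: rotation_def)
    finally show "(\<integral>\<^sup>+x. f (T x) * g y \<partial>?L) = (\<integral>\<^sup>+x. f (T x + y) * g y \<partial>?L)" .
  qed
  also have "\<dots> = (\<integral>\<^sup>+x. (\<integral>\<^sup>+y. f (T x + y) * g y \<partial>?L) \<partial>?L)"
  proof (rule Fubini')
    have "(\<lambda>p. f ((\<lambda>(x, y). T x + y) p) * g (snd p)) \<in> borel_measurable (?L \<Otimes>\<^sub>M ?L)"
      by measurable
    then show "(\<lambda>(x, y). f (T x + y) * g y) \<in> borel_measurable (?L \<Otimes>\<^sub>M ?L)"
      by (simp add: case_prod_beta)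
  qed
  also have "\<dots> = (\<integral>\<^sup>+x. (\<integral>\<^sup>+y. f y * g (y - T x) \<partial>?L) \<partial>?L)"
  proof (rule nn_integral_cong)
    fix x assume x: "x \<in> space ?L"
    have Tx: "T x \<in> Rn n" using TR x by simp
    have m: "(\<lambda>y. y - T x) \<in> measurable ?L ?L"
      using Tx by (intro measurable_into_Rn) (auto intro: coord_space_closed)
    have "(\<integral>\<^sup>+y. f y * g (y - T x) \<partial>?L) = (\<integral>\<^sup>+y. f (y + T x) * g (y + T x - T x) \<partial>?L)"
    proof (rule trans [OF Tx, symmetric])
      note m [measurable]
      show "(\<lambda>y. f y * g (y - T x)) \<in> borel_measurable ?L" by measurable
    qed
    then show "(\<integral>\<^sup>+y. f (T x + y) * g y \<partial>?L) = (\<integral>\<^sup>+y. f y * g (y - T x) \<partial>?L)"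
      by (simp add: add.commute)
  qed
  also have "\<dots> = (\<integral>\<^sup>+y. (\<integral>\<^sup>+x. f y * g (y - T x) \<partial>?L) \<partial>?L)"
  proof (rule Fubini' [symmetric])
    have "(\<lambda>p. f (snd p) * g ((\<lambda>(x, y). y - T x) p)) \<in> borel_measurable (?L \<Otimes>\<^sub>M ?L)"
      by measurable
    then show "(\<lambda>(x, y). f y * g (y - T x)) \<in> borel_measurable (?L \<Otimes>\<^sub>M ?L)"
      by (simp add: case_prod_beta)
  qed
  also have "\<dots> = (\<integral>\<^sup>+y. f y * (\<integral>\<^sup>+x. g x \<partial>?L) \<partial>?L)"
  proof (rule nn_integral_cong)
    fix y assume "y \<in> space ?L"
    then obtain w where w: "w \<in> Rn n" "y = T w" using preimage by auto
    have "g (y - T x) = g (x - w)" if "x \<in> Rn n" for x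
    proof -
      have "y - T x = T (w - x)" using rotation_diff [OF T w(1) that] w by simp
      then have "l2_norm n (y - T x) = l2_norm n (x - w)"
        using T that w coord_space_closed(3) [of w "{1..n}" x] l2_norm_minus_commute [of n w x]
        by (simp add: rotation_def)
      moreover have "y - T x \<in> Rn n" "x - w \<in> Rn n"
        using that w TR by (auto intro!: coord_space_closed)
      ultimately show ?thesis by (simp add: g_def l2_ball_def indicator_def)
    qed
    then have "(\<integral>\<^sup>+x. f y * g (y - T x) \<partial>?L) = (\<integral>\<^sup>+x. f y * g (x - w) \<partial>?L)"
      by (intro nn_integral_cong) simp
    also have "\<dots> = (\<integral>\<^sup>+x. f y * g (x + w - w) \<partial>?L)"
    proof (rule trans [OF w(1), symmetric])
      have [measurable]: "(\<lambda>x. x - w) \<in> measurable ?L ?L"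
        using w by (intro measurable_into_Rn) (auto intro: coord_space_closed)
      show "(\<lambda>x. f y * g (x - w)) \<in> borel_measurable ?L" by measurable
    qed
    also have "\<dots> = f y * (\<integral>\<^sup>+x. g x \<partial>?L)" by (simp add: nn_integral_cmult)
    finally show "(\<integral>\<^sup>+x. f y * g (y - T x) \<partial>?L) = f y * (\<integral>\<^sup>+x. g x \<partial>?L)" .
  qed
  also have "\<dots> = (\<integral>\<^sup>+y. f y \<partial>?L) * (\<integral>\<^sup>+x. g x \<partial>?L)" by (simp add: nn_integral_multc)
  finally have "(\<integral>\<^sup>+x. f (T x) \<partial>?L) * ennreal (unit_ball_vol n)
    = (\<integral>\<^sup>+y. f y \<partial>?L) * ennreal (unit_ball_vol n)"
    by (simp add: g_def emeasure_l2_ball)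
  moreover have "\<not> unit_ball_vol n \<le> 0" by (simp add: not_le)
  ultimately have "(\<integral>\<^sup>+x. f (T x) \<partial>?L) = (\<integral>\<^sup>+y. f y \<partial>?L)"
    by (simp add: mult_right_ennreal_cancel)
  moreover have "(\<integral>\<^sup>+x. f (T x) \<partial>?L) = emeasure (distr ?L ?L T) A"
  proof -
    have "(\<integral>\<^sup>+x. f (T x) \<partial>?L) = (\<integral>\<^sup>+x. f x \<partial>distr ?L ?L T)"
      by (intro nn_integral_distr [symmetric]) simp_all
    then show ?thesis by (simp add: f_def)
  qed
  ultimately show "emeasure (distr ?L ?L T) A = emeasure ?L A" by (simp add: f_def)
qed simp

lemma emeasure_punctured_ball:
  assumes "n \<ge> 1"
  shows "emeasure (lborel_Rn n) (punctured_ball n) = ennreal (unit_ball_vol (real n))"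
proof -
  interpret product_sigma_finite "\<lambda>_ :: nat. lborel :: real measure" by standard
  let ?P = "PiM {1..n} (\<lambda>_. lborel :: real measure)"
  have z: "{0} \<in> sets (restrict_space borel (Rn n))"
    using sets_Rn by (subst sets_restrict_space_iff) (auto simp: coord_space_def)
  have "zero_extend n x = 0 \<longleftrightarrow> (\<forall>i\<in>{1..n}. x i = 0)" for x
    by (auto simp: zero_extend_def fun_eq_iff)
  then have "zero_extend n -` {0} \<inter> space ?P = Pi\<^sub>E {1..n} (\<lambda>_. {0})"
    by (auto simp: space_PiM PiE_iff extensional_def fun_eq_iff)
  then have "emeasure (lborel_Rn n) {0} = 0"
    using assms z emeasure_PiM [of "{1..n}" "\<lambda>_. {0}"] unfolding lborel_Rn_def
    by (subst emeasure_distr [OF measurable_zero_extend]) (simp_all add: power_0_left)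
  then have "{0} \<in> null_sets (lborel_Rn n)" using z by (simp add: null_sets_def sets_lborel_Rn)
  moreover have "l2_ball n \<in> sets (lborel_Rn n)" using sets_l2_ball_Rn by (simp add: sets_lborel_Rn)
  ultimately show ?thesis
    unfolding punctured_ball_def by (simp add: emeasure_Diff_null_set emeasure_l2_ball)
qed

lemma punctured_ball_subset: "punctured_ball n \<subseteq> Rn n"
  by (auto simp: punctured_ball_def l2_ball_def)

lemma sets_punctured_ball_Rn: "punctured_ball n \<in> sets (lborel_Rn n)"
  using sets_punctured_ball sets_Rn punctured_ball_subset
  by (simp add: sets_lborel_Rn sets_restrict_space_iff)

lemma space_sphere_measure [simp]: "space (sphere_measure n) = l2_sphere n"
  by (simp add: sphere_measure_def space_restrict_space)

lemma sets_sphere_measure: "sets (sphere_measure n) = sets (restrict_space borel (l2_sphere n))"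
  by (simp add: sphere_measure_def)

lemma normalize_in_sphere:
  assumes "x \<in> punctured_ball n"
  shows "x /\<^sub>R l2_norm n x \<in> l2_sphere n"
proof -
  have "l2_norm n x \<noteq> 0" "x \<in> Rn n"
    using assms by (auto simp: punctured_ball_def l2_ball_def l2_norm_eq_0_iff)
  then show ?thesis by (auto simp: l2_sphere_def l2_norm_scaleR coord_space_closed)
qed

lemma measurable_normalize:
  "(\<lambda>x. x /\<^sub>R l2_norm n x) \<in>
    measurable (restrict_space (lborel_Rn n) (punctured_ball n)) (restrict_space borel (l2_sphere n))"
proof (rule measurable_restrict_space2)
  show "(\<lambda>x. x /\<^sub>R l2_norm n x) \<in>
      space (restrict_space (lborel_Rn n) (punctured_ball n)) \<rightarrow> l2_sphere n"
    by (auto simp: space_restrict_space intro!: normalize_in_sphere)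
  have "l2_norm n \<in> borel_measurable (lborel_Rn n)"
    unfolding l2_norm_def [abs_def] L2_set_def by measurable
  then have "(\<lambda>x. x /\<^sub>R l2_norm n x) \<in> borel_measurable (lborel_Rn n)"
    by (intro measurable_coordinatewise_then_product) simp
  then show "(\<lambda>x. x /\<^sub>R l2_norm n x) \<in>
      borel_measurable (restrict_space (lborel_Rn n) (punctured_ball n))"
    by (rule measurable_restrict_space1)
qed

lemma emeasure_sphere_measure:
  assumes "n \<ge> 1" "A \<in> sets (sphere_measure n)"
  shows "emeasure (sphere_measure n) A =
    emeasure (lborel_Rn n) {x \<in> punctured_ball n. x /\<^sub>R l2_norm n x \<in> A} /
    ennreal (unit_ball_vol (real n))"
proof -
  let ?R = "restrict_space (lborel_Rn n) (punctured_ball n)"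
  let ?N = "\<lambda>x. x /\<^sub>R l2_norm n x"
  let ?D = "{x \<in> punctured_ball n. ?N x \<in> A}"
  have A: "A \<in> sets (restrict_space borel (l2_sphere n))"
    using assms by (simp add: sets_sphere_measure)
  have space: "space ?R = punctured_ball n"
    using punctured_ball_subset by (auto simp: space_restrict_space)
  have restr: "emeasure ?R B = emeasure (lborel_Rn n) B" if "B \<subseteq> punctured_ball n" for B
    using that sets_punctured_ball_Rn punctured_ball_subset
    by (intro emeasure_restrict_space) (auto simp: Int_absorb2)
  have D: "?N -` A \<inter> space ?R = ?D" by (auto simp: space)
  then have "?D \<in> sets ?R" using measurable_sets [OF measurable_normalize A] by simp
  moreover have "punctured_ball n \<in> sets ?R" using sets.top [of ?R] by (simp add: space)
  ultimately have "emeasure (uniform_measure ?R (punctured_ball n)) ?D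
    = emeasure (lborel_Rn n) ?D / emeasure (lborel_Rn n) (punctured_ball n)"
    using restr [of ?D] restr [of "punctured_ball n"]
    by (simp add: Int_absorb1 subset_eq)
  moreover have "emeasure (sphere_measure n) A = emeasure (uniform_measure ?R (punctured_ball n)) ?D"
    unfolding sphere_measure_def using A D measurable_normalize
    by (subst emeasure_distr) (simp_all cong: measurable_cong_sets)
  ultimately show ?thesis using assms(1) by (simp add: emeasure_punctured_ball)
qed

theorem prob_space_sphere_measure:
  assumes "n \<ge> 1"
  shows "prob_space (sphere_measure n)"
proof
  have "{x \<in> punctured_ball n. x /\<^sub>R l2_norm n x \<in> l2_sphere n} = punctured_ball n"
    using normalize_in_sphere by auto
  moreover have "l2_sphere n \<in> sets (sphere_measure n)"
    using sets.top [of "sphere_measure n"] by simp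
  ultimately show "emeasure (sphere_measure n) (space (sphere_measure n)) = 1"
    using assms unit_ball_vol_pos [of "real n", OF of_nat_0_le_iff, THEN less_imp_neq]
    by (simp add: emeasure_sphere_measure emeasure_punctured_ball divide_ennreal)
qed

theorem sphere_measure_rotation:
  assumes n: "n \<ge> 1" and T: "rotation n T"
  shows "distr (sphere_measure n) (sphere_measure n) T = sphere_measure n"
proof (rule measure_eqI)
  let ?S = "sphere_measure n" and ?L = "lborel_Rn n"
  let ?N = "\<lambda>x. x /\<^sub>R l2_norm n x"
  have TS: "T x \<in> l2_sphere n" if "x \<in> l2_sphere n" for x
    using that T by (auto simp: rotation_def l2_sphere_def)
  have subset: "l2_sphere n \<subseteq> Rn n" by (auto simp: l2_sphere_def)
  then have Int: "Rn n \<inter> l2_sphere n = l2_sphere n" by auto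
  have "T \<in> measurable (restrict_space ?L (l2_sphere n)) ?L"
    by (rule measurable_restrict_space1 [OF rotation_measurable [OF T]])
  moreover have "sets (restrict_space ?L (l2_sphere n)) = sets ?S"
    unfolding sets_sphere_measure sets_restrict_space_cong [OF sets_lborel_Rn]
      sets_restrict_restrict_space Int ..
  ultimately have "T \<in> measurable ?S (restrict_space borel (Rn n))"
    by (simp cong: measurable_cong_sets add: sets_lborel_Rn)
  then have "T \<in> borel_measurable ?S"
    using sets_Rn by (simp add: measurable_restrict_space2_iff)
  then have "T \<in> measurable ?S (restrict_space borel (l2_sphere n))"
    using TS by (intro measurable_restrict_space2) auto
  then have TM: "T \<in> measurable ?S ?S" by (simp cong: measurable_cong_sets add: sets_sphere_measure)
  fix A assume "A \<in> sets (distr ?S ?S T)"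
  then have A: "A \<in> sets ?S" by simp
  define D where "D = {x \<in> punctured_ball n. ?N x \<in> A}"
  define E where "E = {x \<in> punctured_ball n. ?N x \<in> T -` A \<inter> l2_sphere n}"
  have D: "D \<in> sets ?L"
  proof -
    let ?R = "restrict_space ?L (punctured_ball n)"
    have "?N -` A \<inter> space ?R \<in> sets ?R"
      using A by (intro measurable_sets [OF measurable_normalize]) (simp add: sets_sphere_measure)
    moreover have "?N -` A \<inter> space ?R = D"
      using punctured_ball_subset by (auto simp: D_def space_restrict_space)
    ultimately show ?thesis
      using sets_punctured_ball_Rn punctured_ball_subset
      by (simp add: sets_restrict_space_iff Int_absorb2)
  qed
  have "T -` D \<inter> space ?L = E"
  proof -
    have "T x \<in> D \<longleftrightarrow> x \<in> E" if x: "x \<in> Rn n" for x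
    proof -
      have norm: "l2_norm n (T x) = l2_norm n x" and Tx: "T x \<in> Rn n"
        using T x unfolding rotation_def by blast+
      then have "T x \<in> punctured_ball n \<longleftrightarrow> x \<in> punctured_ball n"
        using x by (auto simp: punctured_ball_def l2_ball_def simp flip: l2_norm_eq_0_iff)
      moreover have "?N (T x) = T (?N x)" using T x norm by (simp add: rotation_def)
      ultimately show ?thesis using normalize_in_sphere [of x n] by (auto simp: D_def E_def)
    qed
    moreover have "E \<subseteq> Rn n" using punctured_ball_subset by (auto simp: E_def)
    ultimately show ?thesis by auto
  qed
  then have "emeasure ?L E = emeasure (distr ?L ?L T) D"
    using D by (simp add: emeasure_distr rotation_measurable [OF T])
  then have "emeasure ?L E = emeasure ?L D" by (simp add: lborel_Rn_rotation [OF T])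
  moreover have "T -` A \<inter> l2_sphere n \<in> sets ?S" using measurable_sets [OF TM A] by simp
  ultimately show "emeasure (distr ?S ?S T) A = emeasure ?S A"
    using A TM n by (simp add: emeasure_distr emeasure_sphere_measure D_def E_def)
qed simp


end

theory Submission
  imports Defs
begin

text \<open>
  Let \<open>F\<close> be the polar of \<open>K\<close>, a subset of the Euclidean ball, so that \<open>M\<^sub>K\<close> is the mean over the
  sphere of \<open>sup {\<langle>x, y\<rangle> | y \<in> F}\<close>. Write \<open>L = log (2 / M\<^sub>K)\<close>. Truncating the vectors of \<open>F\<close> at height
  \<open>C M\<^sub>K\<^sup>-\<^sup>2 n\<^sup>-\<^sup>1\<^sup>/\<^sup>2\<close> changes this mean by at most a fraction of \<open>M\<^sub>K\<close>. Since linear functionals on the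
  sphere are subgaussian, Dudley chaining over the roughly \<open>L\<close> dyadic scales between \<open>M\<^sub>K\<close> and \<open>1\<close>
  produces a scale \<open>t\<close> and a \<open>t\<close>-separated set of truncated vectors whose cardinality \<open>N\<close> satisfies
  \<open>log N \<ge> c\<^sub>1 M\<^sub>K\<^sup>2 n / (t\<^sup>2 L\<^sup>2)\<close>.

  After rounding to multiples of \<open>t / (8 n\<^sup>1\<^sup>/\<^sup>2)\<close>, repeatedly splitting this set along a well-chosen
  coordinate and level (Mendelson and Vershynin) shows that it shatters at least \<open>N\<^sup>1\<^sup>/\<^sup>2\<close> sets of
  pairs (coordinate, level). If all of these had at most \<open>V\<close> elements, their number would be at most
  \<open>(e D / V)\<^sup>V\<close>, where \<open>D\<close> is \<open>n\<close> times a power of \<open>1 / M\<^sub>K\<close>, whence \<open>log N \<le> C V L\<close> for \<open>V\<close> of order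
  \<open>c\<^sup>2 M\<^sub>K\<^sup>2 n / (t\<^sup>2 L\<^sup>3)\<close>; this is false for small \<open>c\<close>. A shattered set with more than \<open>V\<close> elements
  yields \<open>\<sigma>\<close>: by symmetry of \<open>K\<close>, the projection of \<open>F\<close> to \<open>\<real>\<^sup>\<sigma>\<close> meets every orthant far from the
  coordinate hyperplanes, which bounds the \<open>\<ell>\<^sub>1\<close> norm on \<open>K \<inter> \<real>\<^sup>\<sigma>\<close>.
\<close>

subsection \<open>Shattering\<close>

lemma sum_odd_over_powers_of_two:
  "(\<Sum>k<K. (2 * real k + 1) / 2 ^ Suc k) = 3 - (2 * real K + 3) / 2 ^ K"
  by (induction K) (auto simp: field_simps)

lemma sum_odd: "(\<Sum>k<d. 2 * real k + 1) = (real d)\<^sup>2"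
  by (induction d) (auto simp: power2_eq_square algebra_simps)

text \<open>Relative to \<open>card A\<close>, \<open>step\<close> says that each tail proportion is
  at most the square of the preceding one; starting from at most 1/2 at level \<open>a + 1\<close>,
  the proportions at least halve from level to level. Writing d^2 as the sum of the first d odd
  numbers turns the second moment above \<open>a\<close> into a weighted sum of these tails, and the
  weighted geometric series stays below 3.\<close>

lemma upper_tail_second_moment:
  fixes Y :: "'b \<Rightarrow> int" and a :: int and A :: "'b set"
  defines "p \<equiv> \<lambda>j. real (card {f \<in> A. Y f \<ge> j})"
  assumes A: "finite A" and step: "\<And>j. real (card A) * p (j + 1) \<le> (p j)\<^sup>2"
    and median: "2 * p (a + 1) \<le> real (card A)"
  shows "(\<Sum>f\<in>A. (real_of_int (max 0 (Y f - a)))\<^sup>2) \<le> 3 * real (card A)"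
proof (cases "A = {}")
  case False
  define N where "N = real (card A)"
  have N: "N > 0" using A False by (simp add: N_def card_gt_0_iff)
  have decay: "p (a + 1 + int k) \<le> N / 2 ^ Suc k" for k
  proof (induction k)
    case 0
    then show ?case using median by (simp add: N_def)
  next
    case (Suc k)
    have "N * p (a + 1 + int k + 1) \<le> (p (a + 1 + int k))\<^sup>2" unfolding N_def by (rule step)
    also have "\<dots> \<le> (N / 2 ^ Suc k)\<^sup>2" using Suc by (intro power_mono) (auto simp: p_def)
    also have "\<dots> = N * (N / (2 ^ Suc k * 2 ^ Suc k))" by (simp add: power2_eq_square)
    finally have "p (a + 1 + int k + 1) \<le> N / (2 ^ Suc k * 2 ^ Suc k)"
      by (rule mult_left_le_imp_le) (rule N)
    also have "\<dots> \<le> N / 2 ^ Suc (Suc k)"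
      using N by (intro divide_left_mono) (auto simp: field_simps)
    finally show ?case by (simp add: algebra_simps)
  qed
  \<comment> \<open>A common cutoff beyond all values \<open>Y f - a\<close>, so that one finite
    range of levels serves every \<open>f\<close>.\<close>
  define K where "K = (\<Sum>f\<in>A. nat (Y f - a))"
  have square: "(real_of_int (max 0 (Y f - a)))\<^sup>2 =
    (\<Sum>k<K. (2 * real k + 1) * of_bool (Y f \<ge> a + 1 + int k))"
    if "f \<in> A" for f
  proof -
    let ?d = "nat (Y f - a)"
    have d: "?d \<le> K" unfolding K_def using A that by (intro member_le_sum) auto
    have "(real_of_int (max 0 (Y f - a)))\<^sup>2 = (real ?d)\<^sup>2" by simp
    also have "\<dots> = (\<Sum>k<?d. 2 * real k + 1)"
      by (rule sum_odd [symmetric])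
    also have "\<dots> = (\<Sum>k<K. (2 * real k + 1) * of_bool (k < ?d))"
      using d by (intro sum.mono_neutral_cong_left) auto
    also have "\<dots> = (\<Sum>k<K. (2 * real k + 1) * of_bool (Y f \<ge> a + 1 + int k))"
      by (intro sum.cong) auto
    finally show ?thesis .
  qed
  have "(\<Sum>f\<in>A. (real_of_int (max 0 (Y f - a)))\<^sup>2)
    = (\<Sum>f\<in>A. \<Sum>k<K. (2 * real k + 1) * of_bool (Y f \<ge> a + 1 + int k))"
    using square by simp
  also have "\<dots> = (\<Sum>k<K. \<Sum>f\<in>A. (2 * real k + 1) * of_bool (Y f \<ge> a + 1 + int k))"
    by (rule sum.swap)
  also have "\<dots> = (\<Sum>k<K. (2 * real k + 1) * p (a + 1 + int k))"
    using A by (simp add: p_def sum_distrib_left [symmetric] Int_def)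
  also have "\<dots> \<le> (\<Sum>k<K. (2 * real k + 1) * (N / 2 ^ Suc k))"
    using decay by (intro sum_mono mult_left_mono) auto
  also have "\<dots> = N * (\<Sum>k<K. (2 * real k + 1) / 2 ^ Suc k)"
    by (simp add: sum_distrib_left mult_ac)
  also have "\<dots> \<le> N * 3"
    unfolding sum_odd_over_powers_of_two using N by (intro mult_left_mono) auto
  finally show ?thesis by (simp add: N_def)
qed simp

text \<open>Take for \<open>a\<close> the largest attained value with at least half of
  \<open>A\<close> at or above it. If more than half of \<open>A\<close> were above
  \<open>a\<close>, the next attained value would be a larger candidate.\<close>

lemma ex_median:
  fixes Y :: "'b \<Rightarrow> int"
  assumes A: "finite A" "A \<noteq> {}"
  obtains a where "2 * card {f \<in> A. Y f \<ge> a + 1} \<le> card A" "2 * card {f \<in> A. Y f \<le> a - 1} \<le> card A"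
proof -
  define S where "S = {y \<in> Y ` A. card A \<le> 2 * card {f \<in> A. Y f \<ge> y}}"
  have "{f \<in> A. Y f \<ge> Min (Y ` A)} = A" using A by auto
  moreover have "Min (Y ` A) \<in> Y ` A" using A by (intro Min_in) auto
  ultimately have "Min (Y ` A) \<in> S" unfolding S_def by simp
  then have S: "finite S" "S \<noteq> {}" using A by (simp add: S_def, blast)
  define a where "a = Max S"
  have "a \<in> S" using S by (simp add: a_def)
  have "card {f \<in> A. Y f \<le> a - 1} + card {f \<in> A. Y f \<ge> a} = card A"
    using A by (subst card_Un_disjoint [symmetric]) (auto intro: arg_cong [where f = card])
  with \<open>a \<in> S\<close> have "2 * card {f \<in> A. Y f \<le> a - 1} \<le> card A" by (simp add: S_def)
  moreover have "2 * card {f \<in> A. Y f \<ge> a + 1} \<le> card A"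
  proof (rule ccontr)
    assume *: "\<not> ?thesis"
    let ?B = "{f \<in> A. Y f \<ge> a + 1}"
    have B: "finite ?B" using A by simp
    have ne: "?B \<noteq> {}" using * by (metis card.empty mult_0_right zero_le)
    define y where "y = Min (Y ` ?B)"
    have y: "y \<in> Y ` ?B" unfolding y_def using B ne by (intro Min_in) auto
    have "\<And>f. f \<in> ?B \<Longrightarrow> y \<le> Y f" unfolding y_def using B by (intro Min_le) auto
    then have "?B \<subseteq> {f \<in> A. Y f \<ge> y}" by auto
    then have "card ?B \<le> card {f \<in> A. Y f \<ge> y}" using A by (intro card_mono) auto
    with * y have "y \<in> S" by (auto simp: S_def)
    then have "y \<le> a" using S by (simp add: a_def)
    with y show False by auto
  qed
  ultimately show ?thesis using that by blast
qed

text \<open>Let N, p and u count \<open>A\<close>, its part at or above \<open>j\<close> and its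
  part above \<open>j\<close>. If both sides are nonempty, sqrt u + sqrt (N - p) < sqrt N.
  Multiplying by sqrt N and using sqrt (N (N - p)) \<ge> N - p gives sqrt (N u) \<le> p, which is
  then squared.\<close>

lemma no_split_tail_step:
  fixes Y :: "'b \<Rightarrow> int"
  assumes A: "finite A"
    and no_split: "\<And>j. {f \<in> A. Y f > j} \<noteq> {} \<Longrightarrow> {f \<in> A. Y f < j} \<noteq> {} \<Longrightarrow>
      sqrt (card {f \<in> A. Y f > j}) + sqrt (card {f \<in> A. Y f < j}) < sqrt (card A)"
  shows "real (card A) * real (card {f \<in> A. Y f \<ge> j + 1}) \<le> (real (card {f \<in> A. Y f \<ge> j}))\<^sup>2"
proof -
  let ?N = "real (card A)" and ?p = "real (card {f \<in> A. Y f \<ge> j})"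
  let ?u = "{f \<in> A. Y f > j}" and ?l = "{f \<in> A. Y f < j}"
  have u: "{f \<in> A. Y f \<ge> j + 1} = ?u" by auto
  have "card ?l + card {f \<in> A. Y f \<ge> j} = card A"
    using A by (subst card_Un_disjoint [symmetric]) (auto intro: arg_cong [where f = card])
  then have l: "real (card ?l) = ?N - ?p" by linarith
  have uN: "real (card ?u) \<le> ?N" using A by (simp add: card_mono)
  show ?thesis
  proof (cases "?u = {} \<or> ?l = {}")
    case True
    then show ?thesis
    proof (elim disjE)
      assume "?u = {}"
      then show ?thesis unfolding u by (simp only: card.empty) simp
    next
      assume "?l = {}"
      then have "{f \<in> A. Y f \<ge> j} = A" by force
      then have "?p = ?N" by simp
      then show ?thesis using uN unfolding u by (simp add: power2_eq_square mult_left_mono)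
    qed
  next
    case False
    then have *: "sqrt (card ?u) < sqrt ?N - sqrt (?N - ?p)" using no_split [of j] l by simp
    have pN: "?p \<le> ?N" using A by (simp add: card_mono)
    have "?N > 0" using False A by (auto simp: card_gt_0_iff)
    have "(?N - ?p)\<^sup>2 \<le> ?N * (?N - ?p)"
      using pN by (simp add: power2_eq_square mult_right_mono)
    then have "?N - ?p \<le> sqrt ?N * sqrt (?N - ?p)"
      unfolding real_sqrt_mult [symmetric] by (rule real_le_rsqrt)
    moreover have "sqrt ?N * sqrt (card ?u) \<le> sqrt ?N * (sqrt ?N - sqrt (?N - ?p))"
      using * by (intro mult_left_mono) auto
    ultimately have "sqrt ?N * sqrt (card ?u) \<le> ?p" by (simp add: algebra_simps)
    then have "(sqrt ?N * sqrt (card ?u))\<^sup>2 \<le> ?p\<^sup>2" by (intro power_mono) auto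
    then show ?thesis unfolding u by (simp add: power_mult_distrib)
  qed
qed

text \<open>Both tails about a median \<open>a\<close> obey the previous bound, the lower one after
  passing to \<open>- Y\<close>, so the squares of \<open>Y f - a\<close> sum to at most
  \<open>6 * card A\<close>. The double sum is \<open>2 * card A\<close> times this sum minus twice
  a square.\<close>

lemma no_split_second_moment:
  fixes Y :: "'b \<Rightarrow> int"
  assumes A: "finite A"
    and no_split: "\<And>j. {f \<in> A. Y f > j} \<noteq> {} \<Longrightarrow> {f \<in> A. Y f < j} \<noteq> {} \<Longrightarrow>
      sqrt (card {f \<in> A. Y f > j}) + sqrt (card {f \<in> A. Y f < j}) < sqrt (card A)"
  shows "(\<Sum>f\<in>A. \<Sum>g\<in>A. (real_of_int (Y f - Y g))\<^sup>2) \<le> 12 * (real (card A))\<^sup>2"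
proof (cases "A = {}")
  case False
  let ?N = "real (card A)"
  obtain a where a: "2 * card {f \<in> A. Y f \<ge> a + 1} \<le> card A"
    "2 * card {f \<in> A. Y f \<le> a - 1} \<le> card A"
    using ex_median [OF A False, of Y] by blast
  have 1: "(\<Sum>f\<in>A. (real_of_int (max 0 (Y f - a)))\<^sup>2) \<le> 3 * ?N"
    by (rule upper_tail_second_moment [OF A]) (use no_split_tail_step [OF A no_split] a(1) in auto)
  have 2: "(\<Sum>f\<in>A. (real_of_int (max 0 (- Y f - (- a))))\<^sup>2) \<le> 3 * ?N"
  proof (rule upper_tail_second_moment [OF A])
    fix j
    have sw: "{f \<in> A. - Y f > j} = {f \<in> A. Y f < - j}"
      "{f \<in> A. - Y f < j} = {f \<in> A. Y f > - j}" for j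
      by auto
    show "?N * real (card {f \<in> A. j + 1 \<le> - Y f}) \<le> (real (card {f \<in> A. j \<le> - Y f}))\<^sup>2"
    proof (rule no_split_tail_step [OF A], unfold sw)
      fix j assume "{f \<in> A. Y f < - j} \<noteq> {}" "{f \<in> A. Y f > - j} \<noteq> {}"
      then show "sqrt (card {f \<in> A. Y f < - j}) + sqrt (card {f \<in> A. Y f > - j}) < sqrt ?N"
        using no_split [of "- j"] by (simp add: add.commute)
    qed
    have "{f \<in> A. - a + 1 \<le> - Y f} = {f \<in> A. Y f \<le> a - 1}" by auto
    then show "2 * real (card {f \<in> A. - a + 1 \<le> - Y f}) \<le> ?N" using a(2) by simp
  qed
  define z where "z = (\<lambda>f. real_of_int (Y f - a))"
  have "(z f)\<^sup>2 = (real_of_int (max 0 (Y f - a)))\<^sup>2 + (real_of_int (max 0 (- Y f - (- a))))\<^sup>2" for f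
    by (cases "Y f \<ge> a") (auto simp: z_def max_def power2_eq_square algebra_simps)
  then have 3: "(\<Sum>f\<in>A. (z f)\<^sup>2) \<le> 6 * ?N" using 1 2 by (simp add: sum.distrib)
  have "(\<Sum>f\<in>A. \<Sum>g\<in>A. (real_of_int (Y f - Y g))\<^sup>2)
    = (\<Sum>f\<in>A. \<Sum>g\<in>A. (z f)\<^sup>2 + (z g)\<^sup>2 - 2 * z f * z g)"
    by (intro sum.cong) (auto simp: z_def power2_eq_square algebra_simps)
  also have "\<dots> = 2 * ?N * (\<Sum>f\<in>A. (z f)\<^sup>2) - 2 * (\<Sum>f\<in>A. z f)\<^sup>2"
  proof -
    have "(\<Sum>f\<in>A. \<Sum>g\<in>A. 2 * z f * z g) = 2 * (\<Sum>f\<in>A. z f)\<^sup>2"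
      by (simp add: power2_eq_square sum_product sum_distrib_left mult_ac)
    then show ?thesis by (simp add: sum.distrib sum_subtractf sum_distrib_left [symmetric])
  qed
  also have "\<dots> \<le> 2 * ?N * (6 * ?N)" using 3 by (intro order_trans [OF _ mult_left_mono [OF 3]]) auto
  finally show ?thesis by (simp add: power2_eq_square)
qed simp

section \<open>Sets of pairs (coordinate, level) shattered by integer functions\<close>

text \<open>A pair \<open>(i, h)\<close> tests on which side of the level \<open>h\<close> the value
  \<open>f i\<close> lies. Both inequalities are strict: values on opposite sides then differ by at
  least 2, which leaves a full grid step when the rounding is undone.\<close>

definition shatters :: "('a \<Rightarrow> int) set \<Rightarrow> ('a \<times> int) set \<Rightarrow> bool"
  where "shatters A P \<longleftrightarrow>
    (\<forall>Q\<subseteq>P. \<exists>f\<in>A. (\<forall>(i, h)\<in>Q. h < f i) \<and> (\<forall>(i, h)\<in>P - Q. f i < h))"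

lemma shattersD:
  assumes "shatters A P" "Q \<subseteq> P"
  shows "\<exists>f\<in>A. (\<forall>i h. (i, h) \<in> Q \<longrightarrow> h < f i) \<and> (\<forall>i h. (i, h) \<in> P - Q \<longrightarrow> f i < h)"
proof -
  from assms obtain f where "f \<in> A" "\<forall>(i, h)\<in>Q. h < f i" "\<forall>(i, h)\<in>P - Q. f i < h"
    unfolding shatters_def by blast
  then show ?thesis by (intro bexI [of _ f]) auto
qed

lemma shatters_mono: "shatters A P \<Longrightarrow> A \<subseteq> B \<Longrightarrow> shatters B P"
  unfolding shatters_def by blast

text \<open>Of two levels at one coordinate, no function lies above the higher and below the lower.
  Thus the set of coordinates of a shattered set has as many elements as the set itself.\<close>

lemma shatters_inj_on_fst:
  assumes "shatters A P"
  shows "inj_on fst P"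
proof (rule inj_onI, clarsimp)
  have False if "(i, h) \<in> P" "(i, h') \<in> P" "h < h'" for i h h'
  proof -
    have "{(i, h')} \<subseteq> P" using that by simp
    from shattersD [OF assms this] obtain f where f: "f \<in> A"
      "\<forall>k h. (k, h) \<in> {(i, h')} \<longrightarrow> h < f k" "\<forall>k h. (k, h) \<in> P - {(i, h')} \<longrightarrow> f k < h"
      by (elim bexE conjE)
    have "h' < f i" "f i < h" using f(2) f(3) [rule_format, of i h] that by auto
    with that show False by simp
  qed
  then show "h = h'" if "(i, h) \<in> P" "(i, h') \<in> P" for i h h'
    using that by (meson linorder_neqE)
qed

text \<open>As in the Sauer--Shelah lemma, a set shattered by both halves stays shattered when the
  splitting point is added to it; this injection compensates for sets counted twice.\<close>

lemma card_shattered_split: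
  fixes A :: "('a \<Rightarrow> int) set" and i :: 'a and j :: int
  defines "U \<equiv> {f \<in> A. f i > j}" and "L \<equiv> {f \<in> A. f i < j}"
  assumes X: "finite X" and ij: "(i, j) \<in> X" and ne: "U \<noteq> {}" "L \<noteq> {}"
  shows "card {P. P \<subseteq> X \<and> shatters U P} + card {P. P \<subseteq> X \<and> shatters L P}
    \<le> card {P. P \<subseteq> X \<and> shatters A P}"
proof -
  define S where "S B = {P. P \<subseteq> X \<and> shatters B P}" for B
  have fin: "finite (S B)" for B
    by (rule finite_subset [of _ "Pow X"]) (use X in \<open>auto simp: S_def\<close>)
  have sub: "S U \<subseteq> S A" "S L \<subseteq> S A"
    using shatters_mono [of U _ A] shatters_mono [of L _ A] by (auto simp: S_def U_def L_def)
  \<comment> \<open>A level at coordinate \<open>i\<close> would have to exceed \<open>j\<close> to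
    have a value of \<open>U\<close> below it, and to be less than \<open>j\<close> to have a value
    of \<open>L\<close> above it.\<close>
  have no_i: "(i, h) \<notin> P" if P: "shatters U P" "shatters L P" for P h
  proof
    assume h: "(i, h) \<in> P"
    obtain f where f: "f \<in> U" "\<forall>k h. (k, h) \<in> P - {} \<longrightarrow> f k < h"
      using shattersD [OF P(1) empty_subsetI] by (elim bexE conjE)
    obtain g where g: "g \<in> L" "\<forall>k h. (k, h) \<in> P \<longrightarrow> h < g k"
      using shattersD [OF P(2) order_refl] by (elim bexE conjE)
    from f(1) f(2) [rule_format, of i h] g(1) g(2) [rule_format, OF h] h show False
      by (auto simp: U_def L_def)
  qed
  have ins: "shatters A (insert (i, j) P)" if P: "shatters U P" "shatters L P" for P
    unfolding shatters_def
  proof (intro allI impI)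
    fix Q assume Q: "Q \<subseteq> insert (i, j) P"
    show "\<exists>f\<in>A. (\<forall>(i, h)\<in>Q. h < f i) \<and> (\<forall>(i, h)\<in>insert (i, j) P - Q. f i < h)"
    proof (cases "(i, j) \<in> Q")
      case True
      have Q': "Q - {(i, j)} \<subseteq> P" using Q by auto
      obtain f where f: "f \<in> U" "\<forall>k h. (k, h) \<in> Q - {(i, j)} \<longrightarrow> h < f k"
        "\<forall>k h. (k, h) \<in> P - (Q - {(i, j)}) \<longrightarrow> f k < h"
        using shattersD [OF P(1) Q'] by (elim bexE conjE)
      have "f \<in> A" "j < f i" using f(1) by (auto simp: U_def)
      with f True show ?thesis by (intro bexI [of _ f]) auto
    next
      case False
      with Q have Q': "Q \<subseteq> P" by auto
      obtain f where f: "f \<in> L" "\<forall>k h. (k, h) \<in> Q \<longrightarrow> h < f k"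
        "\<forall>k h. (k, h) \<in> P - Q \<longrightarrow> f k < h"
        using shattersD [OF P(2) Q'] by (elim bexE conjE)
      have "f \<in> A" "f i < j" using f(1) by (auto simp: L_def)
      with f False show ?thesis by (intro bexI [of _ f]) auto
    qed
  qed
  have notU: "\<not> shatters U P" if "(i, j) \<in> P" for P
  proof
    assume "shatters U P"
    from shattersD [OF this empty_subsetI] obtain f where f: "f \<in> U"
      "\<forall>k h. (k, h) \<in> P - {} \<longrightarrow> f k < h" by (elim bexE conjE)
    from f(1) f(2) [rule_format, of i j] that show False by (auto simp: U_def)
  qed
  have notL: "\<not> shatters L P" if "(i, j) \<in> P" for P
  proof
    assume "shatters L P"
    from shattersD [OF this order_refl] obtain f where f: "f \<in> L"
      "\<forall>k h. (k, h) \<in> P \<longrightarrow> h < f k" by (elim bexE conjE)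
    from f(1) f(2) [rule_format, OF that] show False by (auto simp: L_def)
  qed
  let ?I = "insert (i, j) ` (S U \<inter> S L)"
  have "inj_on (insert (i, j)) (S U \<inter> S L)"
  proof (rule inj_onI)
    fix P Q assume PQ: "P \<in> S U \<inter> S L" "Q \<in> S U \<inter> S L" "insert (i, j) P = insert (i, j) Q"
    then have "(i, j) \<notin> P" "(i, j) \<notin> Q" using no_i by (auto simp: S_def)
    with PQ(3) show "P = Q" by (simp add: insert_ident)
  qed
  then have "card (S U \<inter> S L) = card ?I"
    by (simp only: card_image)
  also have "card (S U \<union> S L) + \<dots> = card ((S U \<union> S L) \<union> ?I)"
  proof (rule card_Un_disjoint [symmetric])
    have "(i, j) \<notin> P" if "P \<in> S U \<union> S L" for P using that notU notL by (auto simp: S_def)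
    then show "(S U \<union> S L) \<inter> ?I = {}" by blast
  qed (use fin in auto)
  also have "\<dots> \<le> card (S A)"
  proof (rule card_mono [OF fin])
    have "?I \<subseteq> S A" using ins ij by (auto simp: S_def)
    then show "(S U \<union> S L) \<union> ?I \<subseteq> S A" using sub by blast
  qed
  finally have "card (S U) + card (S L) \<le> card (S A)"
    by (simp only: card_Un_Int [OF fin fin, of U L])
  then show ?thesis by (simp only: S_def)
qed

text \<open>By averaging: if no coordinate and level split \<open>A\<close> well, the second moment
  bounds sum over \<open>I\<close> to at most 12 \<open>card I\<close> N^2 with N =
  \<open>card A\<close>. Separation makes the same sum exceed 24 \<open>card I\<close> N (N - 1),
  which is at least as large because N \<ge> 2.\<close>

lemma ex_split:
  fixes A :: "('a \<Rightarrow> int) set"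
  assumes A: "finite A" "card A \<ge> 2" and I: "finite I"
    and sep: "\<And>f g. f \<in> A \<Longrightarrow> g \<in> A \<Longrightarrow> f \<noteq> g \<Longrightarrow>
      24 * real (card I) < (\<Sum>i\<in>I. (real_of_int (f i - g i))\<^sup>2)"
  shows "\<exists>i\<in>I. \<exists>j. {f \<in> A. f i > j} \<noteq> {} \<and> {f \<in> A. f i < j} \<noteq> {} \<and>
    sqrt (card A) \<le> sqrt (card {f \<in> A. f i > j}) + sqrt (card {f \<in> A. f i < j})"
proof (rule ccontr)
  assume "\<not> ?thesis"
  then have no: "sqrt (card {f \<in> A. f i > j}) + sqrt (card {f \<in> A. f i < j}) < sqrt (card A)"
    if "i \<in> I" "{f \<in> A. f i > j} \<noteq> {}" "{f \<in> A. f i < j} \<noteq> {}" for i j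
    using that by (meson not_le)
  let ?N = "real (card A)"
  have N: "?N \<ge> 2" using A by simp
  have "(\<Sum>f\<in>A. \<Sum>g\<in>A. \<Sum>i\<in>I. (real_of_int (f i - g i))\<^sup>2)
    = (\<Sum>i\<in>I. \<Sum>f\<in>A. \<Sum>g\<in>A. (real_of_int (f i - g i))\<^sup>2)"
    by (subst (2) sum.swap, subst sum.swap, rule refl)
  also have "\<dots> \<le> (\<Sum>i\<in>I. 12 * ?N\<^sup>2)"
    using no by (intro sum_mono no_split_second_moment [OF A(1)]) auto
  finally have upper: "(\<Sum>f\<in>A. \<Sum>g\<in>A. \<Sum>i\<in>I. (real_of_int (f i - g i))\<^sup>2) \<le> 12 * real (card I) * ?N\<^sup>2"
    by simp
  have row: "24 * real (card I) * (?N - 1) < (\<Sum>g\<in>A. \<Sum>i\<in>I. (real_of_int (f i - g i))\<^sup>2)" if f: "f \<in> A" for f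
  proof -
    have c: "real (card (A - {f})) = ?N - 1" using A f by (simp add: of_nat_diff)
    then have "card (A - {f}) \<noteq> 0" using N by linarith
    then have ne: "A - {f} \<noteq> {}" by force
    have "24 * real (card I) * (?N - 1) = (\<Sum>g\<in>A - {f}. 24 * real (card I))" using c by simp
    also have "\<dots> < (\<Sum>g\<in>A - {f}. \<Sum>i\<in>I. (real_of_int (f i - g i))\<^sup>2)"
      using A f ne sep by (intro sum_strict_mono) auto
    also have "\<dots> \<le> (\<Sum>g\<in>A. \<Sum>i\<in>I. (real_of_int (f i - g i))\<^sup>2)"
      using A by (intro sum_mono2) (auto intro: sum_nonneg)
    finally show ?thesis .
  qed
  have "A \<noteq> {}" using A by auto
  have "12 * real (card I) * ?N\<^sup>2 \<le> ?N * (24 * real (card I) * (?N - 1))"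
  proof -
    have "real (card I) * (?N * ?N) \<le> real (card I) * (?N * (2 * (?N - 1)))"
      using N by (intro mult_left_mono) auto
    then show ?thesis by (simp add: power2_eq_square algebra_simps)
  qed
  also have "\<dots> = (\<Sum>f\<in>A. 24 * real (card I) * (?N - 1))" by simp
  also have "\<dots> < (\<Sum>f\<in>A. \<Sum>g\<in>A. \<Sum>i\<in>I. (real_of_int (f i - g i))\<^sup>2)"
    using A row \<open>A \<noteq> {}\<close> by (intro sum_strict_mono) auto
  finally show False using upper by simp
qed

text \<open>Induction along good splits: both parts are proper and nonempty, the square roots of
  their cardinalities add up to at least \<open>sqrt (card A)\<close>, and the numbers of sets they
  shatter add up as well. A splitting level lies strictly between two attained values, hence in
  \<open>H\<close>. A singleton shatters the empty set.\<close>

theorem sqrt_card_le_card_shattered: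
  fixes A :: "('a \<Rightarrow> int) set"
  assumes "finite A" "A \<noteq> {}" and I: "finite I" and H: "finite H"
    and "\<And>f g. f \<in> A \<Longrightarrow> g \<in> A \<Longrightarrow> f \<noteq> g \<Longrightarrow>
      24 * real (card I) < (\<Sum>i\<in>I. (real_of_int (f i - g i))\<^sup>2)"
    and "\<And>f g i j. f \<in> A \<Longrightarrow> g \<in> A \<Longrightarrow> i \<in> I \<Longrightarrow> f i < j \<Longrightarrow> j < g i \<Longrightarrow> j \<in> H"
  shows "sqrt (card A) \<le> card {P. P \<subseteq> I \<times> H \<and> shatters A P}"
  using assms(1,2,5,6)
proof (induction A rule: finite_psubset_induct)
  case (psubset A)
  let ?S = "\<lambda>B. {P. P \<subseteq> I \<times> H \<and> shatters B P}"
  show ?case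
  proof (cases "card A \<ge> 2")
    case True
    obtain i j where ij: "i \<in> I" "{f \<in> A. f i > j} \<noteq> {}" "{f \<in> A. f i < j} \<noteq> {}"
      "sqrt (card A) \<le> sqrt (card {f \<in> A. f i > j}) + sqrt (card {f \<in> A. f i < j})"
      using ex_split [OF psubset.hyps(1) True I psubset.prems(2)] by blast
    have proper: "{f \<in> A. f i > j} \<subset> A" "{f \<in> A. f i < j} \<subset> A" 
      using ij(2,3) order_less_asym by blast+
    have "j \<in> H" using ij(1,2,3) psubset.prems(3) by blast
    note ij(4)
    also have "sqrt (card {f \<in> A. f i > j}) \<le> card (?S {f \<in> A. f i > j})"
      using ij(2,3) proper psubset.prems by (intro psubset.IH) auto
    also have "sqrt (card {f \<in> A. f i < j}) \<le> card (?S {f \<in> A. f i < j})"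
      using ij(2,3) proper psubset.prems by (intro psubset.IH) auto
    also have "real (card (?S {f \<in> A. f i > j})) + real (card (?S {f \<in> A. f i < j})) \<le> card (?S A)"
      using card_shattered_split [of "I \<times> H" i j A] ij(1,2,3) \<open>j \<in> H\<close> I H
      by (simp flip: of_nat_add)
    finally show ?thesis by simp
  next
    case False
    have "finite (?S A)" by (rule finite_subset [of _ "Pow (I \<times> H)"]) (use I H in auto)
    moreover have "{} \<in> ?S A" using psubset.prems(1) by (auto simp: shatters_def)
    ultimately have "card (?S A) \<ge> 1" by (metis One_nat_def Suc_leI card_gt_0_iff empty_iff)
    moreover have "sqrt (card A) \<le> 1" using False by simp
    ultimately show ?thesis by linarith
  qed
qed

text \<open>Weight a subset \<open>P\<close> by \<open>q ^ card P\<close> with q = V /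
  \<open>card X\<close> \<le> 1. Subsets of size at most \<open>V\<close> have weight at least
  \<open>q powr V\<close>, while all weights together sum to (1 + q)^\<open>card X\<close> \<le> exp
  V.\<close>

lemma card_subsets_le_powr:
  fixes V :: real
  assumes X: "finite X" and V: "0 < V" "V \<le> card X"
  shows "real (card {P. P \<subseteq> X \<and> real (card P) \<le> V}) \<le> (exp 1 * card X / V) powr V"
proof -
  let ?D = "real (card X)"
  define S where "S = {P. P \<subseteq> X \<and> real (card P) \<le> V}"
  have D: "?D > 0" using V by linarith
  let ?q = "V / ?D"
  have q: "0 < ?q" "?q \<le> 1" using V D by auto
  have "real (card S) * ?q powr V = (\<Sum>P\<in>S. ?q powr V)" by simp
  also have "\<dots> \<le> (\<Sum>P\<in>S. ?q ^ card P)"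
    using q by (intro sum_mono) (auto simp: S_def powr_realpow [symmetric] intro!: powr_mono')
  also have "\<dots> \<le> (\<Sum>P\<in>Pow X. ?q ^ card P)"
    using X q by (intro sum_mono2) (auto simp: S_def)
  also have "\<dots> = (\<Prod>x\<in>X. 1 + ?q)"
    using X prod_add [OF X, of "\<lambda>_. ?q" "\<lambda>_. 1"] by (simp add: add.commute)
  also have "\<dots> \<le> exp ?q ^ card X"
    using q by (simp add: power_mono)
  also have "\<dots> = exp V" using D by (simp flip: exp_of_nat_mult)
  finally have "real (card S) \<le> exp V / ?q powr V"
    using q by (subst pos_le_divide_eq) (use V D in auto)
  also have "\<dots> = (exp 1 * ?D / V) powr V"
    using V D by (simp add: powr_divide powr_mult exp_powr_real)
  finally show ?thesis by (simp add: S_def)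
qed

subsection \<open>Linear functionals on the sphere\<close>

definition dot :: "nat \<Rightarrow> (nat \<Rightarrow> real) \<Rightarrow> (nat \<Rightarrow> real) \<Rightarrow> real"
  where "dot n x y = (\<Sum>i\<in>{1..n}. x i * y i)"

lemma dot_commute: "dot n x y = dot n y x"
  by (simp add: dot_def mult.commute)

lemma dot_diff_right: "dot n x (y - z) = dot n x y - dot n x z"
  by (simp add: dot_def algebra_simps sum_subtractf)

lemma dot_minus_left: "dot n (- x) y = - dot n x y"
  by (simp add: dot_def sum_negf)

lemma dot_minus_right: "dot n x (- y) = - dot n x y"
  by (simp add: dot_def sum_negf)

lemma dot_scaleR_left: "dot n (r *\<^sub>R x) y = r * dot n x y"
  by (simp add: dot_def sum_distrib_left mult_ac)

lemma dot_scaleR_right: "dot n x (r *\<^sub>R y) = r * dot n x y"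
  by (simp add: dot_def sum_distrib_left mult_ac)

lemma l2_norm_power2: "(l2_norm n x)\<^sup>2 = (\<Sum>i\<in>{1..n}. (x i)\<^sup>2)"
  by (simp add: l2_norm_def L2_set_def sum_nonneg)

lemma l2_norm_power2_diff:
  "(l2_norm n (x - y))\<^sup>2 = (l2_norm n x)\<^sup>2 - 2 * dot n x y + (l2_norm n y)\<^sup>2"
  by (simp add: l2_norm_power2 dot_def power2_diff sum.distrib sum_subtractf sum_distrib_left mult_ac)

lemma dot_le_l2_norm: "\<bar>dot n x y\<bar> \<le> l2_norm n x * l2_norm n y"
proof -
  have "\<bar>dot n x y\<bar> \<le> (\<Sum>i\<in>{1..n}. \<bar>x i\<bar> * \<bar>y i\<bar>)"
    unfolding dot_def by (rule order_trans [OF sum_abs]) (simp add: abs_mult)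
  also have "\<dots> \<le> l2_norm n x * l2_norm n y"
    unfolding l2_norm_def by (rule L2_set_mult_ineq)
  finally show ?thesis .
qed

section \<open>Spherical caps and the subgaussian behaviour of linear functionals\<close>

lemma measurable_coordinate_sphere [measurable]:
  "(\<lambda>x. x i) \<in> borel_measurable (sphere_measure n)"
  using measurable_restrict_space1 [OF measurable_coordinate_borel [of i], of "l2_sphere n"]
  by (simp cong: measurable_cong_sets add: sets_sphere_measure)

lemma measurable_dot_sphere [measurable]: "(\<lambda>x. dot n x y) \<in> borel_measurable (sphere_measure n)"
  unfolding dot_def by measurable

lemma measurable_l2_norm_diff_Rn [measurable]:
  "(\<lambda>x. l2_norm n (x - w)) \<in> borel_measurable (lborel_Rn n)"
  unfolding l2_norm_def L2_set_def fun_diff_def by measurable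

lemma emeasure_l2_cball:
  assumes w: "w \<in> Rn n" and r: "r > 0"
  shows "emeasure (lborel_Rn n) {x \<in> Rn n. l2_norm n (x - w) \<le> r} =
    ennreal (unit_ball_vol n * r ^ n)"
proof -
  let ?L = "lborel_Rn n" and ?P = "PiM {1..n} (\<lambda>_. lborel :: real measure)"
  let ?B = "{x \<in> Rn n. l2_norm n x \<le> r}" and ?C = "{x \<in> Rn n. l2_norm n (x - w) \<le> r}"
  have C: "?C \<in> sets ?L"
    using measurable_sets [OF measurable_l2_norm_diff_Rn [of n w], of "{..r}"]
    by (simp add: vimage_def Int_def conj_commute)
  have B: "?B \<in> sets (restrict_space borel (Rn n))"
    using measurable_sets [OF measurable_l2_norm_diff_Rn [of n 0], of "{..r}"]
    by (simp add: vimage_def Int_def conj_commute sets_lborel_Rn)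
  have m: "(\<lambda>x. x + w) \<in> measurable ?L ?L"
    using w by (intro measurable_into_Rn) (auto simp: coord_space_def)
  have "(\<lambda>x. x + w) -` ?C \<inter> space ?L = ?B"
    using w by (auto simp: coord_space_closed)
  then have "emeasure ?L ?C = emeasure ?L ?B"
    using emeasure_distr [OF m C] lborel_Rn_translation [OF w] by simp
  also have "zero_extend n -` ?B \<inter> space ?P = {f. sqrt (\<Sum>i\<in>{1..n}. (f i)\<^sup>2) \<le> r} \<inter> space ?P"
    by (auto simp: l2_norm_def L2_set_def zero_extend_def coord_space_def)
  then have "emeasure ?L ?B = ennreal (unit_ball_vol n * r ^ n)"
    using emeasure_cball_aux [of "{1..n}" r] r B unfolding lborel_Rn_def
    by (subst emeasure_distr [OF measurable_zero_extend]) simp_all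
  finally show ?thesis .
qed

text \<open>The cone over a spherical cap of height \<open>u\<close>, cut off by the unit ball, lies in a ball of
  radius \<open>sqrt (1 - u\<^sup>2)\<close>.\<close>

lemma sphere_cap_small:
  assumes n: "n \<ge> 1" and y: "y \<in> Rn n" "l2_norm n y \<le> 1" and u: "0 \<le> u" "2 * u\<^sup>2 \<le> 1"
  shows "measure (sphere_measure n) {x \<in> l2_sphere n. u \<le> dot n x y} \<le> exp (- (n * u\<^sup>2 / 2))"
proof -
  let ?A = "{x \<in> l2_sphere n. u \<le> dot n x y}"
  let ?D = "{x \<in> punctured_ball n. x /\<^sub>R l2_norm n x \<in> ?A}"
  define \<rho> where "\<rho> = sqrt (1 - u\<^sup>2)"
  have \<rho>: "\<rho> > 0" "\<rho>\<^sup>2 = 1 - u\<^sup>2" using u by (auto simp: \<rho>_def)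
  let ?C = "{x \<in> Rn n. l2_norm n (x - u *\<^sub>R y) \<le> \<rho>}"
  have A: "?A \<in> sets (sphere_measure n)"
    using measurable_sets [OF measurable_dot_sphere [of n y], of "{u..}"]
    by (simp add: vimage_def Int_def conj_commute)
  have uy: "u *\<^sub>R y \<in> Rn n" using y by (intro coord_space_closed)
  have C: "?C \<in> sets (lborel_Rn n)"
    using measurable_sets [OF measurable_l2_norm_diff_Rn [of n "u *\<^sub>R y"], of "{..\<rho>}"]
    by (simp add: vimage_def Int_def conj_commute)
  have "?D \<subseteq> ?C"
  proof
    fix x assume x: "x \<in> ?D"
    define r where "r = l2_norm n x"
    have r: "0 < r" "r \<le> 1" and "x \<in> Rn n"
      using x l2_norm_eq_0_iff [of x n] l2_norm_nonneg [of n x]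
      by (auto simp: punctured_ball_def l2_ball_def r_def less_le)
    have "u \<le> dot n x y / r" using x by (simp add: dot_scaleR_left r_def field_simps)
    then have ur: "u * r \<le> dot n x y" using r by (simp add: field_simps)
    have "(l2_norm n (x - u *\<^sub>R y))\<^sup>2 = r\<^sup>2 - 2 * u * dot n x y + u\<^sup>2 * (l2_norm n y)\<^sup>2"
      by (simp add: l2_norm_power2_diff dot_scaleR_right l2_norm_scaleR r_def power_mult_distrib)
    also have "\<dots> \<le> r\<^sup>2 - 2 * u * (u * r) + u\<^sup>2 * 1"
      using u ur y by (intro add_mono diff_mono mult_left_mono) (auto simp: power_le_one)
    \<comment> \<open>The assumption on \<open>u\<close> makes the last product nonnegative: both
      factors are, since \<open>r \<le> 1\<close> and \<open>2 * u\<^sup>2 \<le> 1\<close>.\<close>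
    also have "\<dots> = 1 - u\<^sup>2 - (1 - r) * (1 + r - 2 * u\<^sup>2)"
      by (simp add: power2_eq_square algebra_simps)
    also have "\<dots> \<le> \<rho>\<^sup>2" using r u \<rho> by simp
    finally have "l2_norm n (x - u *\<^sub>R y) \<le> \<rho>"
      using \<rho>(1) by (rule power2_le_imp_le [OF _ less_imp_le])
    then show "x \<in> ?C" using \<open>x \<in> Rn n\<close> by simp
  qed
  then have "emeasure (lborel_Rn n) ?D \<le> emeasure (lborel_Rn n) ?C" using C by (intro emeasure_mono)
  also have "\<dots> = ennreal (unit_ball_vol n * \<rho> ^ n)" using uy \<rho> by (intro emeasure_l2_cball)
  finally have "emeasure (sphere_measure n) ?A \<le>
    ennreal (unit_ball_vol n * \<rho> ^ n) / ennreal (unit_ball_vol n)"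
    unfolding emeasure_sphere_measure [OF n A] by (rule divide_right_mono_ennreal)
  also have "\<dots> = ennreal (\<rho> ^ n)"
    using \<rho> by (subst divide_ennreal) (auto simp: less_imp_neq [OF unit_ball_vol_pos, symmetric])
  finally have "measure (sphere_measure n) ?A \<le> \<rho> ^ n"
    unfolding measure_def using \<rho> by (simp add: enn2real_leI)
  also have "\<rho> \<le> exp (- (u\<^sup>2 / 2))"
  proof (rule power2_le_imp_le)
    have "(exp (- (u\<^sup>2 / 2)))\<^sup>2 = exp (- (u\<^sup>2))" by (simp flip: exp_double)
    then show "\<rho>\<^sup>2 \<le> (exp (- (u\<^sup>2 / 2)))\<^sup>2" using \<rho> exp_ge_add_one_self [of "- (u\<^sup>2)"] by simp
  qed simp
  then have "\<rho> ^ n \<le> exp (- (u\<^sup>2 / 2)) ^ n" using \<rho> by (intro power_mono) auto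
  also have "\<dots> = exp (- (n * u\<^sup>2 / 2))" by (simp flip: exp_of_nat_mult)
  finally show ?thesis .
qed

text \<open>Beyond height sqrt (1/2) the cap is compared with the one at that height, of measure at
  most exp (- n / 4); this is where the rate drops from 1/2 to 1/4. Above height 1 the cap is
  empty.\<close>

lemma sphere_cap:
  assumes n: "n \<ge> 1" and y: "y \<in> Rn n" "l2_norm n y \<le> 1" and u: "0 \<le> u"
  shows "measure (sphere_measure n) {x \<in> l2_sphere n. u \<le> dot n x y} \<le> exp (- (n * u\<^sup>2 / 4))"
proof -
  interpret prob_space "sphere_measure n" using n by (rule prob_space_sphere_measure)
  have sets: "{x \<in> l2_sphere n. v \<le> dot n x y} \<in> events" for v
    using measurable_sets [OF measurable_dot_sphere [of n y], of "{v..}"]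
    by (simp add: vimage_def Int_def conj_commute)
  consider "2 * u\<^sup>2 \<le> 1" | "2 * u\<^sup>2 > 1" "u \<le> 1" | "u > 1" by linarith
  then show ?thesis
  proof cases
    case 1
    then have "prob {x \<in> l2_sphere n. u \<le> dot n x y} \<le> exp (- (n * u\<^sup>2 / 2))"
      using assms by (intro sphere_cap_small)
    also have "\<dots> \<le> exp (- (n * u\<^sup>2 / 4))" by simp
    finally show ?thesis .
  next
    case 2
    have "sqrt (1/2) \<le> u" using 2 u by (intro real_le_lsqrt) auto
    then have "prob {x \<in> l2_sphere n. u \<le> dot n x y} \<le>
      prob {x \<in> l2_sphere n. sqrt (1/2) \<le> dot n x y}"
      using sets by (intro finite_measure_mono) auto
    also have "\<dots> \<le> exp (- (n * (sqrt (1/2))\<^sup>2 / 2))"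
      using n y by (intro sphere_cap_small) auto
    also have "\<dots> \<le> exp (- (n * u\<^sup>2 / 4))"
      using 2 u by (simp add: power_le_one mult_left_le)
    finally show ?thesis .
  next
    case 3
    have "dot n x y \<le> 1" if "x \<in> l2_sphere n" for x
      using dot_le_l2_norm [of n x y] that y by (simp add: l2_sphere_def)
    then have "{x \<in> l2_sphere n. u \<le> dot n x y} = {}" using 3 by force
    then show ?thesis by (simp only: measure_empty) simp
  qed
qed

lemma exp_le_sum_indicator:
  fixes X :: real
  assumes "0 \<le> X" "X \<le> m"
  shows "exp X \<le> (\<Sum>j<Suc m. exp (real j + 1) * of_bool (real j \<le> X))"
proof -
  define j where "j = nat \<lfloor>X\<rfloor>"
  have j: "real j \<le> X" "X \<le> real j + 1" using assms unfolding j_def by linarith+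
  then have "j < Suc m" using assms by linarith
  have "exp X \<le> exp (real j + 1) * of_bool (real j \<le> X)" using j by simp
  also have "\<dots> \<le> (\<Sum>j<Suc m. exp (real j + 1) * of_bool (real j \<le> X))"
    using \<open>j < Suc m\<close> by (intro member_le_sum) auto
  finally show ?thesis .
qed

lemma sphere_square_exponential_integrable:
  assumes n: "n \<ge> 1"
  shows "integrable (sphere_measure n) (\<lambda>x. exp (n * (dot n x y)\<^sup>2 / 8))"
proof -
  interpret prob_space "sphere_measure n" using n by (rule prob_space_sphere_measure)
  have "norm (exp (n * (dot n x y)\<^sup>2 / 8)) \<le> exp (n * (l2_norm n y)\<^sup>2 / 8)"
    if "x \<in> l2_sphere n" for x
  proof -
    have "\<bar>dot n x y\<bar> \<le> l2_norm n y"
      using dot_le_l2_norm [of n x y] that by (simp add: l2_sphere_def)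
    then have "(dot n x y)\<^sup>2 \<le> (l2_norm n y)\<^sup>2"
      by (metis abs_le_square_iff abs_of_nonneg l2_norm_nonneg)
    then show ?thesis by (simp add: mult_left_mono)
  qed
  then show ?thesis
    by (intro integrable_const_bound [where B = "exp (n * (l2_norm n y)\<^sup>2 / 8)"]) auto
qed

text \<open>The factor 1/8 is half the rate of \<open>sphere_cap\<close>: the event that the
  exponent is at least j has probability at most 2 exp (- 2 j), so the weights exp (j + 1) leave a
  convergent geometric series. Levels up to \<open>n\<close> suffice because the inner product is at
  most 1 in absolute value.\<close>

lemma sphere_square_exponential_moment:
  assumes n: "n \<ge> 1" and y: "y \<in> Rn n" "l2_norm n y \<le> 1"
  shows "(\<integral>x. exp (n * (dot n x y)\<^sup>2 / 8) \<partial>sphere_measure n) \<le> 9"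
proof -
  let ?M = "sphere_measure n"
  interpret prob_space ?M using n by (rule prob_space_sphere_measure)
  define A where "A j = {x \<in> l2_sphere n. real j \<le> n * (dot n x y)\<^sup>2 / 8}" for j
  have sets: "A j \<in> events" for j
  proof -
    have "(\<lambda>x. n * (dot n x y)\<^sup>2 / 8) \<in> borel_measurable ?M" by measurable
    from measurable_sets [OF this, of "{real j..}"] show ?thesis
      by (simp add: A_def vimage_def Int_def conj_commute)
  qed
  have int: "integrable ?M (\<lambda>x. exp (real j + 1) * indicator (A j) x)" for j
    by (intro integrable_mult_right integrable_real_indicator sets) (simp add: emeasure_eq_measure)
  have tail: "prob (A j) \<le> 2 * exp (- (2 * real j))" for j
  proof -
    define u where "u = sqrt (8 * j / n)"
    have u: "0 \<le> u" "n * u\<^sup>2 / 4 = 2 * real j" using n by (auto simp: u_def)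
    let ?B = "\<lambda>z. {x \<in> l2_sphere n. u \<le> dot n x z}"
    have B: "?B z \<in> events" for z
      using measurable_sets [OF measurable_dot_sphere [of n z], of "{u..}"]
      by (simp add: vimage_def Int_def conj_commute)
    have my: "- y \<in> Rn n" "l2_norm n (- y) \<le> 1"
      using y by (auto simp: coord_space_def l2_norm_def L2_set_def)
    have "A j \<subseteq> ?B y \<union> ?B (- y)"
    proof
      fix x assume x: "x \<in> A j"
      then have "8 * j / n \<le> (dot n x y)\<^sup>2" using n by (simp add: A_def field_simps)
      then have "u \<le> \<bar>dot n x y\<bar>" unfolding u_def by (metis real_sqrt_abs real_sqrt_le_iff)
      then show "x \<in> ?B y \<union> ?B (- y)" using x by (auto simp: A_def dot_minus_right)
    qed
    then have "prob (A j) \<le> prob (?B y \<union> ?B (- y))" using B by (intro finite_measure_mono) auto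
    also have "\<dots> \<le> prob (?B y) + prob (?B (- y))" using B by (intro measure_Un_le)
    also have "\<dots> \<le> exp (- (n * u\<^sup>2 / 4)) + exp (- (n * u\<^sup>2 / 4))"
      using n y my u by (intro add_mono sphere_cap)
    finally show ?thesis using u by simp
  qed
  have "(\<integral>x. exp (n * (dot n x y)\<^sup>2 / 8) \<partial>?M) \<le>
    (\<integral>x. (\<Sum>j<Suc n. exp (real j + 1) * indicator (A j) x) \<partial>?M)"
  proof (rule integral_mono)
    show "integrable ?M (\<lambda>x. \<Sum>j<Suc n. exp (real j + 1) * indicator (A j) x)"
      by (intro Bochner_Integration.integrable_sum int)
    fix x assume x: "x \<in> space ?M"
    have "\<bar>dot n x y\<bar> \<le> l2_norm n x * l2_norm n y" by (rule dot_le_l2_norm)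
    also have "\<dots> \<le> 1" using x y by (simp add: l2_sphere_def)
    finally have "(dot n x y)\<^sup>2 \<le> 1" by (simp add: abs_square_le_1)
    then have "real n * (dot n x y)\<^sup>2 \<le> real n * 1" by (intro mult_left_mono) auto
    then have "n * (dot n x y)\<^sup>2 / 8 \<le> n" by simp
    from exp_le_sum_indicator [OF _ this]
    show "exp (n * (dot n x y)\<^sup>2 / 8) \<le> (\<Sum>j<Suc n. exp (real j + 1) * indicator (A j) x)"
      using x by (simp add: A_def indicator_def)
  qed (rule sphere_square_exponential_integrable [OF n])
  also have "\<dots> = (\<Sum>j<Suc n. exp (real j + 1) * prob (A j))"
  proof (subst Bochner_Integration.integral_sum [OF int])
    have "A j \<inter> l2_sphere n = A j" for j by (auto simp: A_def)
    then show "(\<Sum>j<Suc n. \<integral>x. exp (real j + 1) * indicator (A j) x \<partial>?M) =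
      (\<Sum>j<Suc n. exp (real j + 1) * prob (A j))"
      by (simp del: sum.lessThan_Suc)
  qed
  also have "\<dots> \<le> (\<Sum>j<Suc n. exp (real j + 1) * (2 * exp (- (2 * real j))))"
    using tail by (intro sum_mono mult_left_mono) auto
  also have "\<dots> = (\<Sum>j<Suc n. 2 * exp 1 * (exp (-1)) ^ j)"
  proof (rule sum.cong [OF refl])
    fix j
    have "exp (real j + 1) * (2 * exp (- (2 * real j))) = 2 * exp ((real j + 1) + - (2 * real j))"
      by (simp only: exp_add mult_ac)
    also have "(real j + 1) + - (2 * real j) = 1 + real j * (-1)" by simp
    also have "2 * exp \<dots> = 2 * exp 1 * (exp (-1)) ^ j"
      unfolding exp_add exp_of_nat_mult by (rule mult.assoc [symmetric])
    finally show "exp (real j + 1) * (2 * exp (- (2 * real j))) = 2 * exp 1 * (exp (-1)) ^ j" .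
  qed
  also have "\<dots> = 2 * exp 1 * (\<Sum>j<Suc n. (exp (-1)) ^ j)" 
    by (rule sum_distrib_left [symmetric])
  also have "\<dots> \<le> 2 * exp 1 * (1 / (1 - exp (-1)))"
  proof (rule mult_left_mono)
    have "(\<Sum>j<Suc n. (exp (-1 :: real)) ^ j) = (1 - exp (-1) ^ Suc n) / (1 - exp (-1))"
      unfolding sum_gp_strict by (rule if_not_P) simp
    also have "\<dots> \<le> 1 / (1 - exp (-1))" by (intro divide_right_mono) auto
    finally show "(\<Sum>j<Suc n. (exp (-1 :: real)) ^ j) \<le> 1 / (1 - exp (-1))" .
  qed simp
  also have "\<dots> \<le> 9"
  proof -
    define e where "e = exp (1 :: real)"
    have e: "2 \<le> e" "e \<le> 3" using exp_ge_add_one_self [of 1] exp_le by (auto simp: e_def)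
    \<comment> \<open>The wanted inequality 2 e^2 \<le> 9 (e - 1) holds exactly between the roots
      3/2 and 3.\<close>
    have "(2 * e - 3) * (e - 3) \<le> 0" using e by (intro mult_nonneg_nonpos) auto
    then have "2 * e * e \<le> 9 * (e - 1)" by (simp add: algebra_simps)
    moreover have "2 * e * (1 / (1 - 1 / e)) = 2 * e * e / (e - 1)"
      using e by (simp add: field_simps)
    ultimately have "2 * e * (1 / (1 - 1 / e)) \<le> 9" using e by (simp add: pos_divide_le_eq)
    then show ?thesis by (simp only: e_def exp_minus inverse_eq_divide)
  qed
  finally show ?thesis .
qed

subsection \<open>Chaining and truncation\<close>

lemma l2_norm_zero [simp]: "l2_norm n 0 = 0"
  by (simp add: l2_norm_def L2_set_def)

text \<open>The maximal inequality for subgaussian variables, with an explicit function in place of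
  the maximum: majorants valid at every point can be added along a chain.\<close>

lemma finite_max_majorant:
  assumes n: "n \<ge> 1" and W: "finite W" "W \<noteq> {}" "W \<subseteq> Rn n" and \<rho>: "\<rho> > 0"
    "\<And>w. w \<in> W \<Longrightarrow> l2_norm n w \<le> \<rho>"
  obtains \<Phi> where "integrable (sphere_measure n) \<Phi>" "\<And>x. 0 \<le> \<Phi> x"
    "\<And>x w. w \<in> W \<Longrightarrow> dot n x w \<le> \<Phi> x"
    "(\<integral>x. \<Phi> x \<partial>sphere_measure n) \<le> \<rho> * sqrt (8 * ln (9 * real (card W)) / n)"
proof -
  let ?M = "sphere_measure n"
  interpret prob_space ?M using n by (rule prob_space_sphere_measure)
  define B where "B = 9 * real (card W)"
  have cW: "real (card W) \<ge> 1" using W by (simp add: Suc_le_eq card_gt_0_iff)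
  then have B: "B \<ge> 9" by (simp add: B_def)
  have "exp 1 \<le> B" using B exp_le by linarith
  then have lnB: "ln B \<ge> 1" using B by (subst ln_ge_iff) auto
  define a where "a = sqrt (8 * ln B / n)"
  have a: "a > 0" "a\<^sup>2 = 8 * ln B / n" using lnB n by (auto simp: a_def)
  define E where "E w x = exp (n * (dot n x (w /\<^sub>R \<rho>))\<^sup>2 / 8)" for w x
  have E: "integrable ?M (E w)" for w
    unfolding E_def by (rule sphere_square_exponential_integrable [OF n])
  have EE: "(\<integral>x. E w x \<partial>?M) \<le> 9" if "w \<in> W" for w
  proof -
    have "l2_norm n (w /\<^sub>R \<rho>) \<le> 1" using \<rho> that by (simp add: l2_norm_scaleR field_simps)
    moreover have "w /\<^sub>R \<rho> \<in> Rn n" using W that by (intro coord_space_closed) auto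
    ultimately show ?thesis unfolding E_def using n by (intro sphere_square_exponential_moment)
  qed
  \<comment> \<open>With u the functional at \<open>x\<close>, this combines u \<le> a/2 + u^2/(2a)
    with the tangent to \<open>ln\<close> at \<open>B\<close>, applied to
    \<open>n * u^2 / 8 = ln (E w x)\<close>. \<open>B\<close> bounds the mean of the sum of the
    \<open>E w\<close>, and \<open>a\<close> balances the two terms, so that the mean is at most
    \<open>a\<close>.\<close>
  define \<Psi> where "\<Psi> x = a / 2 + 4 / (n * a) * (ln B - 1 + (\<Sum>w\<in>W. E w x) / B)" for x
  have E0: "E w x \<ge> 0" for w x by (simp add: E_def)
  have nonneg: "0 \<le> \<Psi> x" for x
    unfolding \<Psi>_def using a B lnB E0
      by (intro add_nonneg_nonneg mult_nonneg_nonneg divide_nonneg_nonneg sum_nonneg) auto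
  have bound: "dot n x w \<le> \<rho> * \<Psi> x" if w: "w \<in> W" for x w
  proof -
    define u where "u = dot n x (w /\<^sub>R \<rho>)"
    have "0 \<le> (a - u)\<^sup>2" by simp
    then have "2 * a * u \<le> a\<^sup>2 + u\<^sup>2" by (simp add: power2_diff)
    then have "u \<le> a / 2 + u\<^sup>2 / (2 * a)" using a(1) by (simp add: field_simps power2_eq_square)
    also have "u\<^sup>2 / (2 * a) = 4 / (n * a) * (n * u\<^sup>2 / 8)" using a n by (simp add: field_simps)
    also have "n * u\<^sup>2 / 8 = ln (E w x)" by (simp add: E_def u_def)
    also have "ln (E w x) = ln B + ln (E w x / B)" using B by (simp add: E_def ln_div)
    also have "ln (E w x / B) \<le> E w x / B - 1" using B by (intro ln_le_minus_one) (simp add: E_def)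
    also have "E w x \<le> (\<Sum>w\<in>W. E w x)" using W w E0 by (intro member_le_sum) auto
    finally have "u \<le> \<Psi> x"
      unfolding \<Psi>_def using a B by (simp add: divide_right_mono mult_left_mono algebra_simps)
    then have "\<rho> * u \<le> \<rho> * \<Psi> x" using \<rho>(1) by (intro mult_left_mono) auto
    moreover have "\<rho> * u = dot n x w" using \<rho>(1) by (simp add: u_def dot_scaleR_right)
    ultimately show ?thesis by simp
  qed
  have sumE: "(\<integral>x. (\<Sum>w\<in>W. E w x) \<partial>?M) \<le> B"
  proof -
    have "(\<integral>x. (\<Sum>w\<in>W. E w x) \<partial>?M) = (\<Sum>w\<in>W. \<integral>x. E w x \<partial>?M)"
      using E by (intro Bochner_Integration.integral_sum)
    also have "\<dots> \<le> (\<Sum>w\<in>W. 9)" using EE by (intro sum_mono)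
    finally show ?thesis by (simp add: B_def)
  qed
  have int: "integrable ?M \<Psi>"
    unfolding \<Psi>_def using E
    by (intro Bochner_Integration.integrable_add integrable_mult_right integrable_divide
        Bochner_Integration.integrable_sum integrable_const)
  have "(\<integral>x. \<Psi> x \<partial>?M) = a / 2 + 4 / (n * a) * (ln B - 1 + (\<integral>x. (\<Sum>w\<in>W. E w x) \<partial>?M) / B)"
    unfolding \<Psi>_def using E prob_space by simp
  also have "\<dots> \<le> a / 2 + 4 / (n * a) * (ln B - 1 + B / B)"
  proof -
    have "(\<integral>x. (\<Sum>w\<in>W. E w x) \<partial>?M) / B \<le> B / B" using sumE B by (intro divide_right_mono) auto
    moreover have "4 / (n * a) \<ge> 0" using a by simp
    ultimately show ?thesis by (intro add_left_mono mult_left_mono) auto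
  qed
  also have "\<dots> = a / 2 + (8 * ln B / n) / (2 * a)" using B a n by (simp add: field_simps)
  also have "\<dots> = a" unfolding a(2) [symmetric] using a(1) by (simp add: power2_eq_square)
  finally have "(\<integral>x. \<rho> * \<Psi> x \<partial>?M) \<le> \<rho> * a" using \<rho> by simp
  with that [of "\<lambda>x. \<rho> * \<Psi> x"] show thesis
    using int nonneg bound \<rho> by (simp add: a_def B_def)
qed

text \<open>The factor 9 under the logarithm is absorbed: with at least two points, 9
  \<open>card T\<close> \<le> \<open>card T\<close>^5. If \<open>T = {0}\<close>, the only link is
  \<open>h 0 = 0\<close>, in accordance with \<open>ln 1 = 0\<close>.\<close>

lemma link_majorant:
  fixes T :: "(nat \<Rightarrow> real) set" and h :: "(nat \<Rightarrow> real) \<Rightarrow> nat \<Rightarrow> real"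
  assumes n: "n \<ge> 1" and T: "finite T" "0 \<in> T" "T \<subseteq> Rn n" and h: "h 0 = 0" "h ` T \<subseteq> Rn n"
    and \<rho>: "\<rho> > 0" "\<And>g. g \<in> T \<Longrightarrow> l2_norm n (h g) \<le> \<rho>"
  obtains \<Phi> where "integrable (sphere_measure n) \<Phi>" "\<And>x. 0 \<le> \<Phi> x"
    "\<And>x g. g \<in> T \<Longrightarrow> dot n x (h g) \<le> \<Phi> x"
    "(\<integral>x. \<Phi> x \<partial>sphere_measure n) \<le> \<rho> * sqrt (40 * ln (card T) / n)"
proof (cases "T = {0}")
  case True
  then show thesis using that [of "\<lambda>_. 0"] h by (simp add: dot_def)
next
  case False
  then obtain g where "g \<in> T" "g \<noteq> 0" using T by auto
  then have "card {0, g} \<le> card T" using T by (intro card_mono) auto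
  then have c: "real (card T) \<ge> 2" using \<open>g \<noteq> 0\<close> by simp
  have W: "finite (h ` T)" "h ` T \<noteq> {}" using T by auto
  have Wc: "card (h ` T) \<le> card T" "card (h ` T) > 0"
    using T W by (auto simp: card_image_le card_gt_0_iff)
  obtain \<Phi> where \<Phi>: "integrable (sphere_measure n) \<Phi>" "\<And>x. 0 \<le> \<Phi> x"
    "\<And>x w. w \<in> h ` T \<Longrightarrow> dot n x w \<le> \<Phi> x"
    "(\<integral>x. \<Phi> x \<partial>sphere_measure n) \<le> \<rho> * sqrt (8 * ln (9 * real (card (h ` T))) / n)"
    using finite_max_majorant [OF n W h(2) \<rho>(1)] \<rho>(2) by blast
  have "9 * real (card (h ` T)) \<le> (real (card T)) ^ 4 * real (card T)"
  proof (rule mult_mono)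
    have "(2 :: real) ^ 4 \<le> real (card T) ^ 4" using c by (intro power_mono) auto
    then show "9 \<le> real (card T) ^ 4" by simp
  qed (use Wc in auto)
  also have "\<dots> = real (card T) ^ 5" by (simp add: eval_nat_numeral)
  finally have "ln (9 * real (card (h ` T))) \<le> ln (real (card T) ^ 5)"
    using Wc by (subst ln_le_cancel_iff) auto
  also have "\<dots> = 5 * ln (card T)" using c by (subst ln_realpow) auto
  finally have "\<rho> * sqrt (8 * ln (9 * real (card (h ` T))) / n) \<le> \<rho> * sqrt (40 * ln (card T) / n)"
    using \<rho> by (intro mult_left_mono) (auto intro!: divide_right_mono)
  with \<Phi> show thesis using that [of \<Phi>] by (meson imageI order_trans)
qed

text \<open>Each \<open>g\<close> of the finest net is approximated by a point
  \<open>\<pi> g\<close> of the preceding one; the functional at \<open>g\<close> is that at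
  \<open>\<pi> g\<close>, controlled by induction, plus that at the short link
  \<open>g - \<pi> g\<close>.\<close>

lemma chaining_nets:
  fixes T :: "nat \<Rightarrow> (nat \<Rightarrow> real) set"
  assumes n: "n \<ge> 1" and T: "\<And>k. k \<le> L \<Longrightarrow> finite (T k) \<and> 0 \<in> T k \<and> T k \<subseteq> Rn n" and T0: "T 0 = {0}"
    and net: "\<And>k g. k < L \<Longrightarrow> g \<in> T (Suc k) \<Longrightarrow> \<exists>h\<in>T k. l2_norm n (g - h) \<le> (1/2) ^ k"
  shows "\<exists>\<Phi>. integrable (sphere_measure n) \<Phi> \<and> (\<forall>x. 0 \<le> \<Phi> x) \<and> (\<forall>x. \<forall>g\<in>T L. dot n x g \<le> \<Phi> x) \<and>
    (\<integral>x. \<Phi> x \<partial>sphere_measure n) \<le> (\<Sum>k<L. (1/2) ^ k * sqrt (40 * ln (card (T (Suc k))) / n))"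
  using T net
proof (induction L)
  case 0
  then show ?case using T0 by (intro exI [of _ "\<lambda>_. 0"]) (simp add: dot_def)
next
  case (Suc L)
  have "\<exists>\<Phi>. integrable (sphere_measure n) \<Phi> \<and> (\<forall>x. 0 \<le> \<Phi> x) \<and> (\<forall>x. \<forall>g\<in>T L. dot n x g \<le> \<Phi> x) \<and>
    (\<integral>x. \<Phi> x \<partial>sphere_measure n) \<le> (\<Sum>k<L. (1/2) ^ k * sqrt (40 * ln (card (T (Suc k))) / n))"
    by (rule Suc.IH) (use Suc.prems in simp_all)
  then obtain \<Phi> where \<Phi>: "integrable (sphere_measure n) \<Phi>" "\<And>x. 0 \<le> \<Phi> x"
    "\<And>x g. g \<in> T L \<Longrightarrow> dot n x g \<le> \<Phi> x"
    "(\<integral>x. \<Phi> x \<partial>sphere_measure n) \<le> (\<Sum>k<L. (1/2) ^ k * sqrt (40 * ln (card (T (Suc k))) / n))"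
    by blast
  have TL: "0 \<in> T L" using Suc.prems(1) [OF le_SucI [OF order_refl]] by (elim conjE)
  \<comment> \<open>The point 0 is sent to 0, so that its link vanishes as
    \<open>link_majorant\<close> demands.\<close>
  have "\<exists>h\<in>T L. l2_norm n (g - h) \<le> (1/2) ^ L \<and> (g = 0 \<longrightarrow> h = 0)" if "g \<in> T (Suc L)" for g
  proof (cases "g = 0")
    case True
    then show ?thesis using TL by (intro bexI [of _ 0]) auto
  next
    case False
    then show ?thesis using Suc.prems(2) [OF lessI that] by blast
  qed
  then have "\<forall>g\<in>T (Suc L). \<exists>h. h \<in> T L \<and> l2_norm n (g - h) \<le> (1/2) ^ L \<and> (g = 0 \<longrightarrow> h = 0)"
    by blast
  from bchoice [OF this] obtain \<pi> where \<pi>: "\<And>g. g \<in> T (Suc L) \<Longrightarrow> \<pi> g \<in> T L"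
    "\<And>g. g \<in> T (Suc L) \<Longrightarrow> l2_norm n (g - \<pi> g) \<le> (1/2) ^ L"
    "\<And>g. g \<in> T (Suc L) \<Longrightarrow> g = 0 \<Longrightarrow> \<pi> g = 0" by blast
  have T': "finite (T (Suc L))" "0 \<in> T (Suc L)" "T (Suc L) \<subseteq> Rn n" "T L \<subseteq> Rn n"
    using Suc.prems(1) [OF order_refl] Suc.prems(1) [OF le_SucI [OF order_refl]] by blast+
  obtain \<Psi> where \<Psi>: "integrable (sphere_measure n) \<Psi>" "\<And>x. 0 \<le> \<Psi> x"
    "\<And>x g. g \<in> T (Suc L) \<Longrightarrow> dot n x (g - \<pi> g) \<le> \<Psi> x"
    "(\<integral>x. \<Psi> x \<partial>sphere_measure n) \<le> (1/2) ^ L * sqrt (40 * ln (card (T (Suc L))) / n)"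
  proof (rule link_majorant [OF n T'(1,2,3), of "\<lambda>g. g - \<pi> g" "(1/2) ^ L"])
    show "0 - \<pi> 0 = 0" using \<pi>(3) T' by simp
    show "(\<lambda>g. g - \<pi> g) ` T (Suc L) \<subseteq> Rn n"
      using T' \<pi>(1) by (auto intro!: coord_space_closed)
  qed (use \<pi>(2) in auto)
  show ?case
  proof (intro exI [of _ "\<lambda>x. \<Phi> x + \<Psi> x"] conjI allI ballI)
    fix x g assume g: "g \<in> T (Suc L)"
    show "dot n x g \<le> \<Phi> x + \<Psi> x"
      using \<Phi>(3) [OF \<pi>(1) [OF g], of x] \<Psi>(3) [OF g, of x] by (simp add: dot_diff_right)
  qed (use \<Phi> \<Psi> in \<open>auto intro: add_mono\<close>)
qed

definition separated :: "nat \<Rightarrow> real \<Rightarrow> (nat \<Rightarrow> real) set \<Rightarrow> bool"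
  where "separated n t A \<longleftrightarrow> (\<forall>f\<in>A. \<forall>g\<in>A. f \<noteq> g \<longrightarrow> t < l2_norm n (f - g))"

text \<open>A separated set of largest cardinality among those containing 0 is a net, since a point
  far from it could be added. The bound \<open>b\<close> ensures that a largest one exists.\<close>

lemma ex_separated_net:
  fixes G :: "(nat \<Rightarrow> real) set"
  assumes t: "0 \<le> t" and G: "0 \<in> G"
    and bounded: "\<And>A. finite A \<Longrightarrow> A \<subseteq> G \<Longrightarrow> separated n t A \<Longrightarrow> card A < b"
  obtains T where "finite T" "0 \<in> T" "T \<subseteq> G" "separated n t T"
    "\<And>g. g \<in> G \<Longrightarrow> \<exists>h\<in>T. l2_norm n (g - h) \<le> t"
proof -
  let ?P = "\<lambda>A. finite A \<and> 0 \<in> A \<and> A \<subseteq> G \<and> separated n t A"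
  have "?P {0}" using G by (simp add: separated_def)
  then obtain T where T: "?P T" "\<And>A. ?P A \<Longrightarrow> card A \<le> card T"
    using ex_has_greatest_nat [of ?P "{0}" card b] bounded by (metis less_imp_le)
  have "\<exists>h\<in>T. l2_norm n (g - h) \<le> t" if g: "g \<in> G" for g
  proof (rule ccontr)
    assume *: "\<not> ?thesis"
    then have far: "t < l2_norm n (g - h)" "t < l2_norm n (h - g)" if "h \<in> T" for h
      using that l2_norm_minus_commute [of n g h] by force+
    have "g \<notin> T" using far(1) [of g] t by (auto simp: l2_norm_def L2_set_def)
    moreover have "?P (insert g T)" using T(1) far g by (auto simp: separated_def)
    then have "card (insert g T) \<le> card T" by (rule T(2))
    ultimately show False using T(1) by simp
  qed
  with T that show thesis by blast
qed

section \<open>Fourth moments and the cost of truncating coordinates\<close>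

text \<open>Apply u^2 / 2 \<le> exp u with u = n x_i^2 / 8, whose exponential moment is at most 9;
  the constant is 128 * 9 = 1152.\<close>

lemma sphere_fourth_moment:
  assumes n: "n \<ge> 1"
  shows "integrable (sphere_measure n) (\<lambda>x. \<Sum>i\<in>{1..n}. x i ^ 4)"
    and "(\<integral>x. (\<Sum>i\<in>{1..n}. x i ^ 4) \<partial>sphere_measure n) \<le> 1152 / n"
proof -
  let ?M = "sphere_measure n"
  have *: "integrable ?M (\<lambda>x. x i ^ 4) \<and> (\<integral>x. x i ^ 4 \<partial>?M) \<le> 1152 / (real n)\<^sup>2"
    if i: "i \<in> {1..n}" for i
  proof -
    define e :: "nat \<Rightarrow> real" where "e = (\<lambda>j. if j = i then 1 else 0)"
    have dot: "dot n x e = x i" for x using i by (simp add: dot_def e_def if_distrib cong: if_cong)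
    have e: "e \<in> Rn n" "l2_norm n e \<le> 1"
    proof -
      show "e \<in> Rn n" using i by (auto simp: e_def coord_space_def)
      have "(l2_norm n e)\<^sup>2 = 1"
        using i by (simp add: l2_norm_power2 e_def if_distrib [of "\<lambda>x. x\<^sup>2"] cong: if_cong)
      then show "l2_norm n e \<le> 1" using power2_le_imp_le [of "l2_norm n e" 1] by simp
    qed
    let ?E = "\<lambda>x :: nat \<Rightarrow> real. exp (n * (x i)\<^sup>2 / 8)"
    have E: "integrable ?M ?E" "(\<integral>x. ?E x \<partial>?M) \<le> 9"
      using sphere_square_exponential_integrable [OF n, of e] sphere_square_exponential_moment [OF n e]
      by (simp_all add: dot)
    have le: "x i ^ 4 \<le> 128 / (real n)\<^sup>2 * ?E x" for x :: "nat \<Rightarrow> real"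
    proof -
      let ?u = "n * (x i)\<^sup>2 / 8"
      have "0 \<le> ?u" by simp
      then have "?u\<^sup>2 / 2 \<le> exp ?u" using exp_lower_Taylor_quadratic [of ?u] by linarith
      then have "128 / (real n)\<^sup>2 * (?u\<^sup>2 / 2) \<le> 128 / (real n)\<^sup>2 * exp ?u"
        by (intro mult_left_mono) auto
      moreover have "128 / (real n)\<^sup>2 * (?u\<^sup>2 / 2) = x i ^ 4"
        using n by (simp add: power2_eq_square eval_nat_numeral)
      ultimately show ?thesis by simp
    qed
    have int: "integrable ?M (\<lambda>x. x i ^ 4)"
    proof (rule Bochner_Integration.integrable_bound)
      show "integrable ?M (\<lambda>x. 128 / (real n)\<^sup>2 * ?E x)" using E(1) by (rule integrable_mult_right)
      show "AE x in ?M. norm (x i ^ 4) \<le> norm (128 / (real n)\<^sup>2 * ?E x)"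
      proof (rule AE_I2)
        fix x :: "nat \<Rightarrow> real"
        have "norm (x i ^ 4) = x i ^ 4" by simp
        also have "\<dots> \<le> 128 / (real n)\<^sup>2 * ?E x" by (rule le)
        also have "\<dots> \<le> norm (128 / (real n)\<^sup>2 * ?E x)" unfolding real_norm_def by (rule abs_ge_self)
        finally show "norm (x i ^ 4) \<le> norm (128 / (real n)\<^sup>2 * ?E x)" .
      qed
      show "(\<lambda>x. x i ^ 4) \<in> borel_measurable ?M" by measurable
    qed
    have "(\<integral>x. x i ^ 4 \<partial>?M) \<le> (\<integral>x. 128 / (real n)\<^sup>2 * ?E x \<partial>?M)"
      using int E(1) le by (intro integral_mono integrable_mult_right)
    also have "\<dots> \<le> 128 / (real n)\<^sup>2 * 9" using E by (simp add: divide_right_mono)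
    finally show ?thesis using int by simp
  qed
  show "integrable ?M (\<lambda>x. \<Sum>i\<in>{1..n}. x i ^ 4)"
    using * by (intro Bochner_Integration.integrable_sum) auto
  have "(\<integral>x. (\<Sum>i\<in>{1..n}. x i ^ 4) \<partial>?M) = (\<Sum>i\<in>{1..n}. \<integral>x. x i ^ 4 \<partial>?M)"
    using * by (intro Bochner_Integration.integral_sum) auto
  also have "\<dots> \<le> (\<Sum>i\<in>{1..n}. 1152 / (real n)\<^sup>2)" using * by (intro sum_mono) auto
  also have "\<dots> = 1152 / n" using n by (simp add: power2_eq_square)
  finally show "(\<integral>x. (\<Sum>i\<in>{1..n}. x i ^ 4) \<partial>?M) \<le> 1152 / n" .
qed

definition clamp_real :: "real \<Rightarrow> real \<Rightarrow> real"
  where "clamp_real r v = max (- r) (min r v)"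

definition truncate :: "real \<Rightarrow> (nat \<Rightarrow> real) \<Rightarrow> nat \<Rightarrow> real"
  where "truncate r y = (\<lambda>i. clamp_real r (y i))"

lemma truncate_in_Rn: "0 \<le> r \<Longrightarrow> y \<in> Rn n \<Longrightarrow> truncate r y \<in> Rn n"
  by (auto simp: coord_space_def truncate_def clamp_real_def)

lemma abs_clamp_real_le: "0 \<le> r \<Longrightarrow> \<bar>clamp_real r v\<bar> \<le> \<bar>v\<bar>" "0 \<le> r \<Longrightarrow> \<bar>clamp_real r v\<bar> \<le> r"
  by (auto simp: clamp_real_def)

lemma l2_norm_truncate_le: "0 \<le> r \<Longrightarrow> l2_norm n (truncate r y) \<le> l2_norm n y"
proof -
  assume r: "0 \<le> r"
  have "(l2_norm n (truncate r y))\<^sup>2 \<le> (l2_norm n y)\<^sup>2"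
    unfolding l2_norm_power2
  proof (rule sum_mono)
    fix i
    have "\<bar>truncate r y i\<bar> \<le> \<bar>y i\<bar>" unfolding truncate_def using r by (rule abs_clamp_real_le)
    then show "(truncate r y i)\<^sup>2 \<le> (y i)\<^sup>2" by (simp only: abs_le_square_iff)
  qed
  then show ?thesis by (rule power2_le_imp_le) simp
qed

text \<open>A product \<open>\<bar>x\<bar> \<bar>v\<bar>\<close> with \<open>\<bar>v\<bar> > r\<close> is at most \<open>\<delta> v\<^sup>2\<close> unless \<open>\<bar>x\<bar> > \<delta> \<bar>v\<bar> > \<delta> r\<close>.\<close>

lemma truncation_error:
  assumes r: "0 < r" and \<delta>: "0 < \<delta>" and y: "l2_norm n y \<le> 1"
  shows "dot n x (y - truncate r y) \<le> \<delta> + (\<Sum>i\<in>{1..n}. x i ^ 4) / (\<delta> ^ 3 * r\<^sup>2)"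
proof -
  have *: "a * (v - clamp_real r v) \<le> \<delta> * v\<^sup>2 + a ^ 4 / (\<delta> ^ 3 * r\<^sup>2)" for a v
  proof (cases "\<bar>v\<bar> \<le> r")
    case True
    then have "clamp_real r v = v" by (auto simp: clamp_real_def)
    then show ?thesis using \<delta> by simp
  next
    case False
    have "\<bar>v - clamp_real r v\<bar> \<le> \<bar>v\<bar>" using r by (auto simp: clamp_real_def)
    then have "\<bar>a\<bar> * \<bar>v - clamp_real r v\<bar> \<le> \<bar>a\<bar> * \<bar>v\<bar>" by (rule mult_left_mono) simp
    moreover have "a * (v - clamp_real r v) \<le> \<bar>a\<bar> * \<bar>v - clamp_real r v\<bar>"
      unfolding abs_mult [symmetric] by (rule abs_ge_self)
    ultimately have av: "a * (v - clamp_real r v) \<le> \<bar>a\<bar> * \<bar>v\<bar>" by (rule order_trans [rotated])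
    have pos: "0 \<le> a ^ 4 / (\<delta> ^ 3 * r\<^sup>2)" using \<delta> by simp
    show ?thesis
    proof (cases "\<bar>a\<bar> \<le> \<delta> * \<bar>v\<bar>")
      case True
      then have "\<bar>a\<bar> * \<bar>v\<bar> \<le> \<delta> * \<bar>v\<bar> * \<bar>v\<bar>" by (rule mult_right_mono) simp
      also have "\<dots> = \<delta> * v\<^sup>2"
        unfolding power2_eq_square mult.assoc abs_mult_self_eq by (rule refl)
      also have "\<dots> \<le> \<delta> * v\<^sup>2 + a ^ 4 / (\<delta> ^ 3 * r\<^sup>2)" using pos by linarith
      finally show ?thesis using av by linarith
    next
      case False
      then have v: "\<bar>v\<bar> \<le> \<bar>a\<bar> / \<delta>" using \<delta> by (simp add: field_simps)
      have "\<delta> * r \<le> \<delta> * \<bar>v\<bar>" using \<open>\<not> \<bar>v\<bar> \<le> r\<close> \<delta> by simp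
      then have "\<delta> * r \<le> \<bar>a\<bar>" using False by linarith
      then have "(\<delta> * r)\<^sup>2 \<le> \<bar>a\<bar>\<^sup>2" using \<delta> r by (intro power_mono) auto
      then have "1 \<le> a\<^sup>2 / (\<delta> * r)\<^sup>2" using \<delta> r by simp
      then have "a\<^sup>2 / \<delta> * 1 \<le> a\<^sup>2 / \<delta> * (a\<^sup>2 / (\<delta> * r)\<^sup>2)" using \<delta> by (intro mult_left_mono) auto
      also have "\<dots> = a ^ 4 / (\<delta> ^ 3 * r\<^sup>2)"
        by (simp add: power_mult_distrib eval_nat_numeral mult_ac)
      finally have "a\<^sup>2 / \<delta> \<le> a ^ 4 / (\<delta> ^ 3 * r\<^sup>2)" by simp
      moreover have "\<bar>a\<bar> * \<bar>v\<bar> \<le> \<bar>a\<bar> * (\<bar>a\<bar> / \<delta>)" using v by (intro mult_left_mono) auto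
      moreover have "\<bar>a\<bar> * (\<bar>a\<bar> / \<delta>) = a\<^sup>2 / \<delta>" by (simp add: power2_eq_square)
      moreover have "0 \<le> \<delta> * v\<^sup>2" using \<delta> by simp
      ultimately show ?thesis using av by linarith
    qed
  qed
  have "dot n x (y - truncate r y) = (\<Sum>i\<in>{1..n}. x i * (y i - clamp_real r (y i)))"
    by (simp add: dot_def truncate_def)
  also have "\<dots> \<le> (\<Sum>i\<in>{1..n}. \<delta> * (y i)\<^sup>2 + x i ^ 4 / (\<delta> ^ 3 * r\<^sup>2))" using * by (intro sum_mono)
  also have "\<dots> = \<delta> * (l2_norm n y)\<^sup>2 + (\<Sum>i\<in>{1..n}. x i ^ 4) / (\<delta> ^ 3 * r\<^sup>2)"
    by (simp add: sum.distrib l2_norm_power2 sum_distrib_left sum_divide_distrib)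
  also have "\<dots> \<le> \<delta> + (\<Sum>i\<in>{1..n}. x i ^ 4) / (\<delta> ^ 3 * r\<^sup>2)"
    using \<delta> y by (simp add: mult_left_le power_le_one)
  finally show ?thesis .
qed

subsection \<open>Polar bodies and separated sets\<close>

definition polar :: "nat \<Rightarrow> (nat \<Rightarrow> real) set \<Rightarrow> (nat \<Rightarrow> real) set"
  where "polar n K = {y \<in> Rn n. \<forall>k\<in>K. dot n k y \<le> 1}"

lemma dot_self: "dot n x x = (l2_norm n x)\<^sup>2"
  unfolding l2_norm_power2 by (simp add: dot_def power2_eq_square)

lemma normalized_in_l2_ball: "y \<in> Rn n \<Longrightarrow> y /\<^sub>R l2_norm n y \<in> l2_ball n"
  by (cases "l2_norm n y = 0") (auto simp: l2_ball_def l2_norm_scaleR coord_space_closed)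

lemma l2_norm_polar_le:
  assumes "l2_ball n \<subseteq> K" "y \<in> polar n K"
  shows "l2_norm n y \<le> 1"
proof -
  have y: "y \<in> Rn n" using assms(2) by (simp add: polar_def)
  then have "dot n (y /\<^sub>R l2_norm n y) y \<le> 1"
    using assms normalized_in_l2_ball [OF y] by (auto simp: polar_def)
  then have "inverse (l2_norm n y) * (l2_norm n y * l2_norm n y) \<le> 1"
    by (simp only: dot_scaleR_left dot_self power2_eq_square)
  then show ?thesis by (cases "l2_norm n y = 0") (simp_all add: field_simps)
qed

lemma zero_in_polar: "0 \<in> polar n K"
  by (simp add: polar_def dot_def coord_space_closed)

lemma continuous_on_l2_norm_diff: "continuous_on S (\<lambda>k. l2_norm n (z - k))"
  unfolding l2_norm_def L2_set_def fun_diff_def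
  by (intro continuous_intros continuous_on_subset [OF continuous_on_product_coordinates]) auto

text \<open>The separating functional comes from the point of \<open>K\<close> nearest to \<open>z\<close>.\<close>

lemma ex_polar_separating:
  assumes K: "K \<subseteq> Rn n" "convex K" "compact K" "l2_ball n \<subseteq> K" and z: "z \<in> Rn n" "z \<notin> K"
  obtains y where "y \<in> polar n K" "1 < dot n z y"
proof -
  have "0 \<in> l2_ball n" by (simp add: l2_ball_def coord_space_closed)
  then have "K \<noteq> {}" using K by auto
  then obtain p where p: "p \<in> K" "\<And>k. k \<in> K \<Longrightarrow> l2_norm n (z - p) \<le> l2_norm n (z - k)"
    using continuous_attains_inf [OF K(3) _ continuous_on_l2_norm_diff, of n z] by blast
  define y where "y = z - p"
  have yR: "y \<in> Rn n" using z p K by (auto simp: y_def intro!: coord_space_closed)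
  have "y \<noteq> 0" using z p by (auto simp: y_def)
  then have y0: "l2_norm n y > 0"
    using yR l2_norm_eq_0_iff [of y n] l2_norm_nonneg [of n y] by linarith
  have le: "dot n k y \<le> dot n p y" if k: "k \<in> K" for k
  proof (rule ccontr)
    assume not_le: "\<not> ?thesis"
    define d where "d = dot n y (k - p)"
    have d: "d > 0" using not_le by (simp add: d_def dot_diff_right dot_commute [of n _ y])
    define q where "q = (l2_norm n (k - p))\<^sup>2"
    have "q \<ge> 0" by (simp add: q_def)
    \<comment> \<open>With this step length, moving from \<open>p\<close> towards \<open>k\<close>
      stays in \<open>K\<close> by convexity and comes closer to \<open>z\<close>: the gain 2 s d
      outweighs the quadratic term s^2 q.\<close>
    define s where "s = min 1 (d / (q + 1))"
    have s: "0 < s" "s \<le> 1" using d \<open>q \<ge> 0\<close> by (auto simp: s_def)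
    have "s \<le> d / (q + 1)" by (simp add: s_def)
    then have "s * (q + 1) \<le> d" using \<open>q \<ge> 0\<close> by (simp add: pos_le_divide_eq)
    then have sq: "s * q < 2 * d" using s d by (simp add: algebra_simps)
    have "(1 - s) *\<^sub>R p + s *\<^sub>R k \<in> K" using K(2) p(1) k s by (intro convexD) auto
    from p(2) [OF this] have "(l2_norm n y)\<^sup>2 \<le> (l2_norm n (z - ((1 - s) *\<^sub>R p + s *\<^sub>R k)))\<^sup>2"
      unfolding y_def by (intro power_mono) auto
    also have "z - ((1 - s) *\<^sub>R p + s *\<^sub>R k) = y - s *\<^sub>R (k - p)"
      by (simp add: y_def fun_eq_iff algebra_simps)
    also have "(l2_norm n \<dots>)\<^sup>2 = (l2_norm n y)\<^sup>2 - 2 * s * d + s * (s * q)"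
      unfolding l2_norm_power2_diff [of n y] dot_scaleR_right l2_norm_scaleR power_mult_distrib power2_abs d_def q_def
      by (simp add: power2_eq_square)
    also have "\<dots> = (l2_norm n y)\<^sup>2 - s * (2 * d - s * q)" by (simp add: algebra_simps)
    finally have "s * (2 * d - s * q) \<le> 0" by simp
    moreover have "s * (2 * d - s * q) > 0" using s sq by simp
    ultimately show False by simp
  qed
  \<comment> \<open>The normalization of \<open>y\<close> lies in the ball and hence in
    \<open>K\<close>, so \<open>m\<close> is at least the norm of \<open>y\<close>. Being positive,
    it may be used to scale \<open>y\<close> into the polar.\<close>
  define m where "m = dot n p y"
  have "y /\<^sub>R l2_norm n y \<in> K" using K normalized_in_l2_ball [OF yR] by auto
  from le [OF this] have "inverse (l2_norm n y) * (l2_norm n y * l2_norm n y) \<le> m"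
    by (simp only: m_def dot_scaleR_left dot_self power2_eq_square)
  then have "l2_norm n y \<le> m" using y0 by (simp add: field_simps)
  then have m: "m > 0" using y0 by linarith
  have "y /\<^sub>R m \<in> Rn n" using yR by (rule coord_space_closed)
  moreover have "dot n k (y /\<^sub>R m) \<le> 1" if "k \<in> K" for k
    using le [OF that] m unfolding dot_scaleR_right m_def [symmetric] by (simp add: field_simps)
  ultimately have "y /\<^sub>R m \<in> polar n K" by (simp add: polar_def)
  moreover have "1 < dot n z (y /\<^sub>R m)"
  proof -
    have "dot n y y = dot n y z - dot n y p" using dot_diff_right [of n y z p] by (simp only: y_def)
    then have "dot n z y = m + (l2_norm n y)\<^sup>2"
      by (simp add: m_def dot_self dot_commute [of n y])
    then show ?thesis using m y0 unfolding dot_scaleR_right by (simp add: field_simps)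
  qed
  ultimately show thesis by (rule that)
qed

section \<open>The Minkowski functional and its mean\<close>

lemma minkowski_functional_le:
  assumes "0 < b" "x \<in> (*\<^sub>R) b ` K"
  shows "minkowski_functional K x \<le> b"
  unfolding minkowski_functional_def using assms by (intro cInf_lower bdd_belowI [of _ 0]) auto

text \<open>A lower bound for a real infimum needs a nonempty set. The radius
  \<open>l2_norm n x + 1\<close> supplies a member, the summand 1 covering
  \<open>x = 0\<close>.\<close>

lemma minkowski_functional_nonneg:
  assumes "l2_ball n \<subseteq> K" "x \<in> Rn n"
  shows "0 \<le> minkowski_functional K x"
proof -
  define t where "t = l2_norm n x + 1"
  have t: "t > 0" unfolding t_def using l2_norm_nonneg [of n x] by linarith
  then have "x /\<^sub>R t \<in> l2_ball n"
    using assms by (auto simp: l2_ball_def l2_norm_scaleR coord_space_closed t_def field_simps)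
  moreover have "x = t *\<^sub>R (x /\<^sub>R t)" using t by (simp add: fun_eq_iff)
  ultimately have "x \<in> (*\<^sub>R) t ` K" using assms by blast
  then show ?thesis unfolding minkowski_functional_def using t by (intro cInf_greatest) auto
qed

text \<open>The substantial half of the bipolar theorem: if \<open>x / b\<close> were outside
  \<open>K\<close>, a separating element of the polar would have product greater than
  \<open>b\<close> with \<open>x\<close>.\<close>

lemma minkowski_functional_le_polar:
  assumes K: "K \<subseteq> Rn n" "convex K" "compact K" "l2_ball n \<subseteq> K" and x: "x \<in> Rn n" and b: "0 < b"
    and le: "\<And>y. y \<in> polar n K \<Longrightarrow> dot n x y \<le> b"
  shows "minkowski_functional K x \<le> b"
proof (rule minkowski_functional_le [OF b])
  have "x /\<^sub>R b \<in> K"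
  proof (rule ccontr)
    assume "x /\<^sub>R b \<notin> K"
    then obtain y where "y \<in> polar n K" "1 < dot n (x /\<^sub>R b) y"
      using ex_polar_separating [OF K, of "x /\<^sub>R b"] x coord_space_closed(4) by blast
    then show False using le [of y] b by (simp add: dot_scaleR_left field_simps)
  qed
  moreover have "x = b *\<^sub>R (x /\<^sub>R b)" using b by (simp add: fun_eq_iff)
  ultimately show "x \<in> (*\<^sub>R) b ` K" by blast
qed

lemma mean_norm_bounds:
  assumes n: "n \<ge> 1" and K: "l2_ball n \<subseteq> K"
  shows "0 \<le> mean_norm n K" "mean_norm n K \<le> 1"
proof -
  interpret prob_space "sphere_measure n" using n by (rule prob_space_sphere_measure)
  show "0 \<le> mean_norm n K"
    unfolding mean_norm_def using minkowski_functional_nonneg [OF K]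
    by (intro Bochner_Integration.integral_nonneg) (auto simp: l2_sphere_def)
  have "mean_norm n K \<le> (\<integral>x. 1 \<partial>sphere_measure n)"
    unfolding mean_norm_def
  \<comment> \<open>This rule asks integrability of the nonnegative majorant only, because a
    non-integrable function has integral 0.\<close>
  proof (rule integral_mono')
    fix x assume "x \<in> space (sphere_measure n)"
    then have "x \<in> l2_ball n" by (auto simp: l2_sphere_def l2_ball_def)
    then have "1 *\<^sub>R x \<in> (*\<^sub>R) 1 ` K" using K by blast
    then show "minkowski_functional K x \<le> 1" by (intro minkowski_functional_le) auto
  qed auto
  then show "mean_norm n K \<le> 1" using prob_space by simp
qed

section \<open>A large separated set in the truncated polar\<close>

text \<open>Take the first dyadic scale at or below M / 4; the one before exceeds M / 4, whence the
  lower bound M / 8. Then 2^L \<le> 4 (2 / M), and logarithms together with ln 2 \<ge> 2/3 and ln 2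
  \<le> ln (2 / M) bound L.\<close>

lemma ex_dyadic_scale:
  fixes M :: real
  assumes "0 < M" "M \<le> 1"
  obtains L where "(1/2) ^ L \<le> M / 4" "M / 8 \<le> (1/2) ^ L" "real L \<le> 5 * ln (2 / M)"
proof -
  let ?P = "\<lambda>L. (1/2 :: real) ^ L \<le> M / 4"
  obtain j where "(1/2 :: real) ^ j < M / 4"
    using assms real_arch_pow_inv [of "M / 4" "1/2"] by auto
  then have j: "?P j" by simp
  have "\<not> ?P 0" using assms by simp
  with ex_least_nat_less [of ?P j, OF j] obtain k where k: "\<not> ?P k" "?P (Suc k)" by blast
  define L where "L = Suc k"
  have L: "(1/2) ^ L \<le> M / 4" using k(2) by (simp only: L_def)
  have M8: "M / 8 \<le> (1/2) ^ L" using k(1) unfolding L_def power_Suc by linarith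
  have "(1/2) ^ L * (2 :: real) ^ L = 1" by (simp add: power_one_over)
  then have "M / 8 * 2 ^ L \<le> 1" using mult_right_mono [OF M8, of "2 ^ L"] by simp
  then have "(2 :: real) ^ L \<le> 8 / M" using assms by (simp add: pos_le_divide_eq mult.commute)
  then have "ln ((2 :: real) ^ L) \<le> ln (8 / M)" using assms by (subst ln_le_cancel_iff) auto
  then have "L * ln 2 \<le> ln (4 * (2 / M))" by (simp add: ln_realpow)
  also have "\<dots> = ln (2 ^ 2) + ln (2 / M)" using assms by (subst ln_mult) auto
  also have "ln ((2 :: real) ^ 2) = 2 * ln 2" by (subst ln_realpow) auto
  also have "ln (2 :: real) \<le> ln (2 / M)"
    using assms by (subst ln_le_cancel_iff) (auto simp: field_simps)
  finally have *: "L * ln 2 \<le> 3 * ln (2 / M)" by simp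
  have "real L * (2/3) \<le> L * ln 2" using ln2_ge_two_thirds by (intro mult_left_mono) auto
  moreover have "0 \<le> ln (2 / M)" using assms by (intro ln_ge_zero) (auto simp: field_simps)
  ultimately have "real L \<le> 5 * ln (2 / M)" using * by linarith
  with L M8 show thesis by (rule that)
qed

text \<open>If separated sets were small at all scales from M / 8 to 1, the mean would be at most 3
  M / 4: M / 8 from chaining, M / 4 from the distance to the last net, and M / 4 + M / 8 from
  truncation.\<close>

lemma ex_large_separated_set:
  assumes n: "n \<ge> 1" and K: "K \<subseteq> Rn n" "convex K" "compact K" "l2_ball n \<subseteq> K"
    and M: "M = mean_norm n K" "0 < M"
    and r: "r = 768 / (M\<^sup>2 * sqrt n)"
  obtains t A where "M / 8 \<le> t" "t \<le> 1" "finite A" "A \<subseteq> truncate r ` polar n K" "separated n t A"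
    "exp (M\<^sup>2 * n / (256000 * t\<^sup>2 * (ln (2 / M))\<^sup>2)) \<le> card A"
proof (rule ccontr)
  note obt = that
  let ?S = "sphere_measure n"
  interpret prob_space ?S using n by (rule prob_space_sphere_measure)
  have M1: "M \<le> 1" using mean_norm_bounds [OF n K(4)] M by simp
  define ell where "ell = ln (2 / M)"
  have ell: "ell > 0" unfolding ell_def using M M1 by (intro ln_gt_zero) (auto simp: field_simps)
  have r0: "r > 0" using M n unfolding r by simp
  define G where "G = truncate r ` polar n K"
  define H where "H t = M\<^sup>2 * n / (256000 * t\<^sup>2 * ell\<^sup>2)" for t
  assume no: "\<not> thesis"
  have small: "card A < exp (H t)"
    if "M / 8 \<le> t" "t \<le> 1" "finite A" "A \<subseteq> G" "separated n t A" for t A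
  proof (rule ccontr)
    assume "\<not> ?thesis"
    then have "exp (H t) \<le> card A" by simp
    with that have thesis unfolding H_def G_def ell_def by (intro obt)
    with no show False ..
  qed
  obtain L where L: "(1/2) ^ L \<le> M / 4" "M / 8 \<le> (1/2) ^ L" "real L \<le> 5 * ell"
    using ex_dyadic_scale [OF M(2) M1] unfolding ell_def by blast
  have "truncate r 0 = 0" using r0 by (simp add: truncate_def clamp_real_def fun_eq_iff)
  then have G0: "0 \<in> G" unfolding G_def using zero_in_polar by (metis imageI)
  have GR: "G \<subseteq> Rn n" unfolding G_def polar_def
    using truncate_in_Rn [OF less_imp_le [OF r0]] by blast
  have G1: "l2_norm n g \<le> 1" if g: "g \<in> G" for g
  proof -
    obtain y where "g = truncate r y" "y \<in> polar n K" using g unfolding G_def by blast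
    then show ?thesis using l2_norm_truncate_le [of r n y] l2_norm_polar_le [OF K(4), of y] r0
      by simp
  qed
  have scale: "M / 8 \<le> (1/2) ^ k" "(1/2 :: real) ^ k \<le> 1" if "k \<le> L" for k
  proof -
    have "(1/2 :: real) ^ L \<le> (1/2) ^ k" using that by (intro power_decreasing) auto
    then show "M / 8 \<le> (1/2) ^ k" using L by linarith
  qed (simp add: power_le_one)
  have "\<exists>T. finite T \<and> 0 \<in> T \<and> T \<subseteq> G \<and> real (card T) < exp (H ((1/2) ^ k)) \<and>
    (\<forall>g\<in>G. \<exists>h\<in>T. l2_norm n (g - h) \<le> (1/2) ^ k)" if k: "k \<le> L" for k
  proof -
    obtain T where T: "finite T" "0 \<in> T" "T \<subseteq> G" "separated n ((1/2) ^ k) T"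
      "\<And>g. g \<in> G \<Longrightarrow> \<exists>h\<in>T. l2_norm n (g - h) \<le> (1/2) ^ k"
    proof (rule ex_separated_net [of "(1/2) ^ k" G n "nat \<lceil>exp (H ((1/2) ^ k))\<rceil>"])
      fix A assume "finite A" "A \<subseteq> G" "separated n ((1/2) ^ k) A"
      with small [OF scale [OF k]] have "card A < exp (H ((1/2) ^ k))" by blast
      then show "card A < nat \<lceil>exp (H ((1/2) ^ k))\<rceil>" by linarith
    qed (use G0 in auto)
    with small [OF scale [OF k]] show ?thesis by blast
  qed
  then have "\<forall>k\<in>{..L}. \<exists>T. finite T \<and> 0 \<in> T \<and> T \<subseteq> G \<and> real (card T) < exp (H ((1/2) ^ k)) \<and>
    (\<forall>g\<in>G. \<exists>h\<in>T. l2_norm n (g - h) \<le> (1/2) ^ k)" by blast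
  from bchoice [OF this] obtain T' where T': "\<forall>k\<in>{..L}. finite (T' k) \<and> 0 \<in> T' k \<and> T' k \<subseteq> G \<and>
    real (card (T' k)) < exp (H ((1/2) ^ k)) \<and> (\<forall>g\<in>G. \<exists>h\<in>T' k. l2_norm n (g - h) \<le> (1/2) ^ k)"
    by (elim exE)
  \<comment> \<open>The truncated polar lies in the unit ball, so \<open>{0}\<close> is a net at
    scale 1 and the chain can start from the zero functional.\<close>
  define T where "T k = (if k = 0 then {0} else T' k)" for k
  have T: "finite (T k) \<and> 0 \<in> T k \<and> T k \<subseteq> G" if "k \<le> L" for k
    using T' that G0 by (auto simp: T_def)
  have net: "\<exists>h\<in>T k. l2_norm n (g - h) \<le> (1/2) ^ k" if "k \<le> L" "g \<in> G" for k g
    using T' that G1 [OF that(2)] by (cases "k = 0") (auto simp: T_def)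
  have "\<exists>\<Phi>. integrable ?S \<Phi> \<and> (\<forall>x. 0 \<le> \<Phi> x) \<and> (\<forall>x. \<forall>g\<in>T L. dot n x g \<le> \<Phi> x) \<and>
    (\<integral>x. \<Phi> x \<partial>?S) \<le> (\<Sum>k<L. (1/2) ^ k * sqrt (40 * ln (card (T (Suc k))) / n))"
  proof (rule chaining_nets [OF n])
    fix k g assume "k < L" "g \<in> T (Suc k)"
    then have "k \<le> L" "g \<in> G" using T [of "Suc k"] by auto
    then show "\<exists>h\<in>T k. l2_norm n (g - h) \<le> (1/2) ^ k" by (rule net)
  next
    fix k assume "k \<le> L"
    then show "finite (T k) \<and> 0 \<in> T k \<and> T k \<subseteq> Rn n" using T GR by blast
  qed (simp add: T_def)
  then obtain \<Phi> where \<Phi>: "integrable ?S \<Phi>" "\<And>x. 0 \<le> \<Phi> x" "\<And>x g. g \<in> T L \<Longrightarrow> dot n x g \<le> \<Phi> x"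
    "(\<integral>x. \<Phi> x \<partial>?S) \<le> (\<Sum>k<L. (1/2) ^ k * sqrt (40 * ln (card (T (Suc k))) / n))"
    by blast
  note \<Phi>(4)
  also have "(\<Sum>k<L. (1/2) ^ k * sqrt (40 * ln (card (T (Suc k))) / n)) \<le> (\<Sum>k<L. M / (40 * ell))"
  proof (rule sum_mono)
    fix k assume "k \<in> {..<L}"
    then have k: "Suc k \<le> L" by simp
    define t :: real where "t = (1/2) ^ Suc k"
    have t: "t > 0" "(1/2) ^ k = 2 * t" by (simp_all add: t_def)
    have "card (T (Suc k)) > 0" using T [OF k] by (auto simp: card_gt_0_iff)
    moreover have "real (card (T (Suc k))) < exp (H t)" 
      using bspec [OF T', of "Suc k"] k unfolding T_def t_def by (simp del: power_Suc)
    ultimately have "ln (real (card (T (Suc k)))) \<le> ln (exp (H t))"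
      by (subst ln_le_cancel_iff) auto
    then have "ln (card (T (Suc k))) \<le> H t" by simp
    then have "sqrt (40 * ln (card (T (Suc k))) / n) \<le> sqrt (40 * H t / n)"
      by (intro real_sqrt_le_mono divide_right_mono) auto
    \<comment> \<open>Since 256000 = 40 * 80^2, each scale costs M / (40 \<open>ell\<close>), and at
      most 5 \<open>ell\<close> scales cost M / 8 together.\<close>
    also have "40 * H t / n = (M / (80 * t * ell))\<^sup>2"
      using n by (simp add: H_def power2_eq_square field_simps)
    also have "sqrt \<dots> = M / (80 * t * ell)" using M t ell by simp
    finally have "2 * t * sqrt (40 * ln (card (T (Suc k))) / n) \<le> 2 * t * (M / (80 * t * ell))"
      using t by (intro mult_left_mono) auto
    also have "\<dots> = M / (40 * ell)" using t by simp
    finally show "(1/2) ^ k * sqrt (40 * ln (card (T (Suc k))) / n) \<le> M / (40 * ell)"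
      unfolding t(2) .
  qed
  also have "\<dots> = L * (M / (40 * ell))" by simp
  also have "\<dots> \<le> 5 * ell * (M / (40 * ell))" using L M ell by (intro mult_right_mono) auto
  also have "\<dots> = M / 8" using ell by simp
  finally have \<Phi>M: "(\<integral>x. \<Phi> x \<partial>?S) \<le> M / 8" .

  \<comment> \<open>The error term of \<open>truncation_error\<close> for \<delta> = M / 4. The
    factor 768 in \<open>r\<close> makes the bound for its mean exactly M / 8.\<close>
  define Q where "Q x = (\<Sum>i\<in>{1..n}. x i ^ 4) / ((M / 4) ^ 3 * r\<^sup>2)" for x :: "nat \<Rightarrow> real"
  have Q: "integrable ?S Q" "(\<integral>x. Q x \<partial>?S) \<le> M / 8"
  proof -
    show "integrable ?S Q" unfolding Q_def using sphere_fourth_moment(1) [OF n] by simp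
    have "(\<integral>x. Q x \<partial>?S) = (\<integral>x. (\<Sum>i\<in>{1..n}. x i ^ 4) \<partial>?S) / ((M / 4) ^ 3 * r\<^sup>2)"
      unfolding Q_def by simp
    also have "\<dots> \<le> (1152 / n) / ((M / 4) ^ 3 * r\<^sup>2)"
      using sphere_fourth_moment(2) [OF n] M by (intro divide_right_mono) auto
    also have "\<dots> = M / 8"
      using M n unfolding r by (simp add: power_divide power_mult_distrib eval_nat_numeral field_simps)
    finally show "(\<integral>x. Q x \<partial>?S) \<le> M / 8" .
  qed
  have Q0: "Q x \<ge> 0" for x unfolding Q_def using M by (intro divide_nonneg_nonneg sum_nonneg) auto
  have "minkowski_functional K x \<le> \<Phi> x + Q x + M / 2" if x: "x \<in> space ?S" for x
  proof (rule minkowski_functional_le_polar [OF K])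
    have x1: "x \<in> Rn n" "l2_norm n x = 1" using x by (auto simp: l2_sphere_def)
    then show "x \<in> Rn n" by simp
    show "0 < \<Phi> x + Q x + M / 2" using \<Phi>(2) [of x] Q0 [of x] M by linarith
    fix y assume y: "y \<in> polar n K"
    then have g: "truncate r y \<in> G" by (simp add: G_def)
    obtain h where h: "h \<in> T L" "l2_norm n (truncate r y - h) \<le> (1/2) ^ L"
      using net [OF order_refl g] by blast
    have "dot n x (truncate r y - h) \<le> M / 4"
      using dot_le_l2_norm [of n x "truncate r y - h"] x1 h(2) L(1) by simp
    moreover have "dot n x (y - truncate r y) \<le> M / 4 + Q x"
      unfolding Q_def using truncation_error [OF r0 _ l2_norm_polar_le [OF K(4) y], of "M / 4" x] M by simp
    moreover have "dot n x h \<le> \<Phi> x" using h(1) by (rule \<Phi>(3))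
    ultimately show "dot n x y \<le> \<Phi> x + Q x + M / 2" by (simp add: dot_diff_right)
  qed
  then have "mean_norm n K \<le> (\<integral>x. \<Phi> x + Q x + M / 2 \<partial>?S)"
    unfolding mean_norm_def using \<Phi>(1,2) Q(1) Q0 M(2)
    by (intro integral_mono') (auto intro!: add_nonneg_nonneg)
  then have "M \<le> (\<integral>x. \<Phi> x + Q x + M / 2 \<partial>?S)" by (simp only: M(1))
  also have "\<dots> = (\<integral>x. \<Phi> x \<partial>?S) + (\<integral>x. Q x \<partial>?S) + M / 2"
    using \<Phi>(1) Q(1) prob_space by simp
  also have "\<dots> \<le> M / 8 + M / 8 + M / 2" using \<Phi>M Q(2) by simp
  finally show False using M by simp
qed

subsection \<open>Coordinate sections\<close>

text \<open>Clamping is monotone and 1-Lipschitz, so a positive gap between truncated values was at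
  least as large before. This leads from truncated vectors back to points of the polar.\<close>

lemma le_diff_of_le_diff_clamp_real:
  "0 < s \<Longrightarrow> s \<le> clamp_real r a - clamp_real r b \<Longrightarrow> s \<le> a - b"
  by (auto simp: clamp_real_def max_def min_def split: if_splits)

lemma floor_gap:
  fixes a b s :: real
  assumes "0 < s" "h < \<lfloor>a / s\<rfloor>" "\<lfloor>b / s\<rfloor> < h"
  shows "s \<le> a - b"
proof -
  have "real_of_int h + 1 \<le> a / s" using assms(2) by linarith
  moreover have "b / s < real_of_int h" using assms(3) by linarith
  ultimately have "1 \<le> (a - b) / s" by (simp add: diff_divide_distrib)
  then show ?thesis using assms(1) by simp
qed

text \<open>Shattering yields \<open>y1\<close> following the sign pattern of \<open>x\<close> and
  \<open>y2\<close> following the opposite one, so \<open>x i * (y1 i - y2 i)\<close> is at least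
  \<open>s\<close> times the absolute value of \<open>x i\<close>, whatever the levels are. As
  \<open>x\<close> and \<open>- x\<close> lie in \<open>K\<close>, these products sum to at most
  2.\<close>

lemma l1_bound_of_shattered:
  assumes K: "symmetric K" and s: "0 < s" and A: "A \<subseteq> truncate r ` polar n K"
    and P: "shatters ((\<lambda>f i. \<lfloor>f i / s\<rfloor>) ` A) P" "fst ` P \<subseteq> {1..n}"
    and x: "x \<in> K" "x \<in> coord_space (fst ` P)"
  shows "(\<Sum>i\<in>fst ` P. \<bar>x i\<bar>) \<le> 2 / s"
proof -
  let ?Y = "\<lambda>f i. \<lfloor>f i / s\<rfloor>"
  define Q where "Q = {(i, h) \<in> P. 0 \<le> x i}"
  have QP: "Q \<subseteq> P" "P - Q \<subseteq> P" by (auto simp: Q_def)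
  obtain f1 where f1: "f1 \<in> ?Y ` A" "\<forall>i h. (i, h) \<in> Q \<longrightarrow> h < f1 i" "\<forall>i h. (i, h) \<in> P - Q \<longrightarrow> f1 i < h"
    using shattersD [OF P(1) QP(1)] by (elim bexE conjE)
  obtain f2 where f2: "f2 \<in> ?Y ` A" "\<forall>i h. (i, h) \<in> P - Q \<longrightarrow> h < f2 i"
    "\<forall>i h. (i, h) \<in> P - (P - Q) \<longrightarrow> f2 i < h"
    using shattersD [OF P(1) QP(2)] by (elim bexE conjE)
  obtain y1 where y1: "y1 \<in> polar n K" "f1 = ?Y (truncate r y1)" using f1(1) A by blast
  obtain y2 where y2: "y2 \<in> polar n K" "f2 = ?Y (truncate r y2)" using f2(1) A by blast
  have "s * \<bar>x i\<bar> \<le> x i * (y1 i - y2 i)" if i: "i \<in> fst ` P" for i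
  proof -
    obtain h where h: "(i, h) \<in> P" using i by auto
    show ?thesis
    proof (cases "0 \<le> x i")
      case True
      then have "(i, h) \<in> Q" "(i, h) \<in> P - (P - Q)" using h by (auto simp: Q_def)
      then have "h < f1 i" "f2 i < h" using f1(2) f2(3) by blast+
      then have "s \<le> truncate r y1 i - truncate r y2 i"
        unfolding y1(2) y2(2) by (rule floor_gap [OF s])
      then have "s \<le> y1 i - y2 i"
        unfolding truncate_def by (rule le_diff_of_le_diff_clamp_real [OF s])
      then have "x i * s \<le> x i * (y1 i - y2 i)" using True by (rule mult_left_mono)
      then show ?thesis using True by (simp add: mult.commute)
    next
      case False
      then have "(i, h) \<in> P - Q" using h by (auto simp: Q_def)
      then have "h < f2 i" "f1 i < h" using f1(3) f2(2) by blast+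
      then have "s \<le> truncate r y2 i - truncate r y1 i"
        unfolding y1(2) y2(2) by (rule floor_gap [OF s])
      then have "s \<le> y2 i - y1 i"
        unfolding truncate_def by (rule le_diff_of_le_diff_clamp_real [OF s])
      then have "(- x i) * s \<le> (- x i) * (y2 i - y1 i)" using False by (intro mult_left_mono) auto
      then show ?thesis using False by (simp add: algebra_simps)
    qed
  qed
  then have "s * (\<Sum>i\<in>fst ` P. \<bar>x i\<bar>) \<le> (\<Sum>i\<in>fst ` P. x i * (y1 i - y2 i))"
    unfolding sum_distrib_left by (intro sum_mono)
  also have "\<dots> = dot n x (y1 - y2)"
    unfolding dot_def using P(2) x(2)
      by (intro sum.mono_neutral_cong_left) (auto simp: coord_space_def)
  also have "\<dots> = dot n x y1 + dot n (- x) y2" by (simp add: dot_diff_right dot_minus_left)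
  also have "\<dots> \<le> 1 + 1"
  proof (rule add_mono)
    show "dot n x y1 \<le> 1" using y1(1) x(1) by (simp add: polar_def)
    have "- x \<in> uminus ` K" using x(1) by (rule imageI)
    then have "- x \<in> K" using K unfolding symmetric_def by (simp only:)
    then show "dot n (- x) y2 \<le> 1" using y2(1) by (simp add: polar_def)
  qed
  finally show ?thesis using s by (simp add: field_simps)
qed

section \<open>Rounding to a grid and comparing entropy with counting\<close>

text \<open>Rounding changes a difference, in grid steps, by at most 1, and (d + 1)^2 \<le> 2 d^2 +
  2. The squared distance exceeds 64 n squared grid steps, so that of the rounded vectors exceeds
  (64 n - 2 n) / 2 = 31 n.\<close>

lemma discretization_separated:
  assumes n: "n \<ge> 1" and t: "t > 0" and fg: "t < l2_norm n (f - g)"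
    and s: "s = t / (8 * sqrt n)"
  shows "24 * real (card {1..n}) < (\<Sum>i\<in>{1..n}. (real_of_int (\<lfloor>f i / s\<rfloor> - \<lfloor>g i / s\<rfloor>))\<^sup>2)"
proof -
  let ?D = "\<lambda>i. real_of_int (\<lfloor>f i / s\<rfloor> - \<lfloor>g i / s\<rfloor>)"
  have s0: "s > 0" using n t by (simp add: s)
  have le: "((f i - g i) / s)\<^sup>2 \<le> 2 * (?D i)\<^sup>2 + 2" for i
  proof -
    have "\<bar>f i / s - g i / s\<bar> \<le> \<bar>?D i\<bar> + 1" by linarith
    then have "(f i / s - g i / s)\<^sup>2 \<le> (\<bar>?D i\<bar> + 1)\<^sup>2"
      by (intro abs_le_square_iff [THEN iffD1]) linarith
    also have "\<dots> = 2 * (?D i)\<^sup>2 + 2 - (\<bar>?D i\<bar> - 1)\<^sup>2"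
      by (simp add: power2_eq_square algebra_simps)
    also have "\<dots> \<le> 2 * (?D i)\<^sup>2 + 2" by simp
    finally show ?thesis by (simp add: diff_divide_distrib)
  qed
  have "t\<^sup>2 < (l2_norm n (f - g))\<^sup>2" using t fg by (intro power_strict_mono) auto
  then have "t\<^sup>2 / s\<^sup>2 < (l2_norm n (f - g))\<^sup>2 / s\<^sup>2"
    using s0 by (intro divide_strict_right_mono) auto
  moreover have "t\<^sup>2 / s\<^sup>2 = 64 * n" using n t by (simp add: s power_divide power_mult_distrib)
  moreover have "(l2_norm n (f - g))\<^sup>2 / s\<^sup>2 = (\<Sum>i\<in>{1..n}. ((f i - g i) / s)\<^sup>2)"
    by (simp add: l2_norm_power2 sum_divide_distrib power_divide)
  moreover have "\<dots> \<le> (\<Sum>i\<in>{1..n}. 2 * (?D i)\<^sup>2 + 2)" using le by (intro sum_mono)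
  moreover have "\<dots> = 2 * (\<Sum>i\<in>{1..n}. (?D i)\<^sup>2) + 2 * n" by (simp add: sum.distrib sum_distrib_left)
  ultimately have "64 * real n < 2 * (\<Sum>i\<in>{1..n}. (?D i)\<^sup>2) + 2 * real n" by linarith
  then show ?thesis using n by simp
qed

text \<open>The ratio under the logarithm is at most a fixed power of 2 / M, so the logarithm costs
  one factor \<open>ell\<close>. It turns the \<open>ell ^ 3\<close> in \<open>V\<close> into the
  \<open>ell^2\<close> of the entropy bound, and 2 * 85 * 256 / 10^20 is below 1 / 256000. These
  three factors \<open>ell\<close> are the source of the exponent 3/2 in the theorem.\<close>

lemma entropy_contradiction:
  fixes M t V D :: real and n :: nat
  defines "ell \<equiv> ln (2 / M)"
  assumes n: "n \<ge> 1" and M: "0 < M" "M \<le> 1" and t: "M / 8 \<le> t" "t \<le> 1"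
    and V: "V = 256 * (M / 10 ^ 10)\<^sup>2 * n / (ell ^ 3 * t\<^sup>2)"
    and D: "n \<le> D" "D \<le> 3 * real n * (6144 / (M\<^sup>2 * t))"
  shows "0 < V" "V \<le> D" "2 * (V * ln (exp 1 * D / V)) < M\<^sup>2 * n / (256000 * t\<^sup>2 * ell\<^sup>2)"
proof -
  have t0: "t > 0" using M t by linarith
  have u: "2 \<le> 2 / M" using M by (simp add: field_simps)
  have "ln 2 \<le> ell" unfolding ell_def using u M by (subst ln_le_cancel_iff) auto
  then have ell: "2/3 \<le> ell" using ln2_ge_two_thirds by linarith
  have "ell \<le> 2 / M - 1" unfolding ell_def using M by (intro ln_le_minus_one) simp
  then have ell_le: "ell \<le> 2 / M" by simp
  have n0: "real n > 0" using n by simp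
  show V0: "0 < V" unfolding V using M ell t0 n0 by (intro divide_pos_pos mult_pos_pos) auto
  have "V \<le> n"
  proof -
    have "M\<^sup>2 \<le> (8 * t)\<^sup>2" using M t by (intro power_mono) auto
    then have "M\<^sup>2 \<le> 64 * t\<^sup>2" by (simp add: power_mult_distrib)
    then have "256 / 10 ^ 20 * M\<^sup>2 \<le> 256 / 10 ^ 20 * (64 * t\<^sup>2)" by (intro mult_left_mono) auto
    also have "\<dots> = 256 / 10 ^ 20 * 64 * t\<^sup>2" by simp
    also have "\<dots> \<le> ell ^ 3 * t\<^sup>2"
    proof (rule mult_right_mono)
      have "(2/3) ^ 3 \<le> ell ^ 3" using ell by (intro power_mono) auto
      moreover have "256 / 10 ^ 20 * 64 \<le> (2/3 :: real) ^ 3" by (simp add: eval_nat_numeral)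
      ultimately show "256 / 10 ^ 20 * 64 \<le> ell ^ 3" by (rule order_trans [rotated])
    qed simp
    finally have "256 * (M / 10 ^ 10)\<^sup>2 \<le> ell ^ 3 * t\<^sup>2" by (simp add: power_divide)
    then have "256 * (M / 10 ^ 10)\<^sup>2 * n \<le> ell ^ 3 * t\<^sup>2 * n" by (intro mult_right_mono) auto
    then show ?thesis unfolding V using ell t0 by (simp add: field_simps)
  qed
  with D show "V \<le> D" by linarith
  have D0: "D > 0" using D n0 by linarith
  have "exp 1 * D \<le> 3 * (3 * real n * (6144 / (M\<^sup>2 * t)))"
    using exp_le D D0 by (intro mult_mono) auto
  then have "exp 1 * D / V \<le> 3 * (3 * real n * (6144 / (M\<^sup>2 * t))) / V"
    using V0 by (intro divide_right_mono) auto
  also have "\<dots> = 216 * 10 ^ 20 * ell ^ 3 * t / M ^ 4"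
    unfolding V using M t0 n0 ell by (simp add: power_divide eval_nat_numeral field_simps)
  \<comment> \<open>Crude estimates suffice inside the logarithm: \<open>ell \<le> 2 / M\<close> and
    \<open>t \<le> 1\<close>, after which 2 / M \<ge> 2 absorbs the numerical constant.\<close>
  also have "\<dots> \<le> 216 * 10 ^ 20 * (2 / M) ^ 3 * 1 / M ^ 4"
    using ell ell_le t t0 M by (intro divide_right_mono mult_mono power_mono) auto
  also have "\<dots> = 216 * 10 ^ 20 / 16 * (2 / M) ^ 7"
    using M by (simp add: power_divide eval_nat_numeral)
  also have "\<dots> \<le> 2 ^ 78 * (2 / M) ^ 7" using M by (intro mult_right_mono) auto
  also have "\<dots> \<le> (2 / M) ^ 78 * (2 / M) ^ 7" using u M by (intro mult_right_mono power_mono) auto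
  also have "\<dots> = (2 / M) ^ 85" by (simp flip: power_add)
  finally have "ln (exp 1 * D / V) \<le> ln ((2 / M) ^ 85)"
    using D0 V0 M by (subst ln_le_cancel_iff) auto
  also have "\<dots> = 85 * ell" using M unfolding ell_def by (subst ln_realpow) auto
  finally have "2 * (V * ln (exp 1 * D / V)) \<le> 2 * (V * (85 * ell))" using V0 by simp
  also have "\<dots> = 43520 / 10 ^ 20 * (M\<^sup>2 * n / (t\<^sup>2 * ell\<^sup>2))"
    unfolding V using ell t0 by (simp add: power_divide eval_nat_numeral field_simps)
  also have "\<dots> < 1 / 256000 * (M\<^sup>2 * n / (t\<^sup>2 * ell\<^sup>2))"
    using M n0 t0 ell by (intro mult_strict_right_mono divide_pos_pos mult_pos_pos) auto
  finally show "2 * (V * ln (exp 1 * D / V)) < M\<^sup>2 * n / (256000 * t\<^sup>2 * ell\<^sup>2)" by simp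
qed

section \<open>Existence of the coordinate section\<close>

lemma scaled_section_subset:
  assumes "\<sigma> \<noteq> {}" "finite \<sigma>" "0 \<le> m"
    "\<And>x. x \<in> K \<Longrightarrow> x \<in> coord_space \<sigma> \<Longrightarrow> m * (\<Sum>i\<in>\<sigma>. \<bar>x i\<bar>) \<le> sqrt (card \<sigma>)"
  shows "(*\<^sub>R) m ` (K \<inter> coord_space \<sigma>) \<subseteq> (*\<^sub>R) (sqrt (real (card \<sigma>))) ` l1_ball \<sigma>"
proof
  fix z assume "z \<in> (*\<^sub>R) m ` (K \<inter> coord_space \<sigma>)"
  then obtain x where x: "z = m *\<^sub>R x" "x \<in> K" "x \<in> coord_space \<sigma>" by auto
  define q where "q = sqrt (real (card \<sigma>))"
  have q: "q > 0" using assms(1,2) by (simp add: q_def card_gt_0_iff)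
  have "(\<Sum>i\<in>\<sigma>. \<bar>m / q * x i\<bar>) = m * (\<Sum>i\<in>\<sigma>. \<bar>x i\<bar>) / q"
    using q assms(3) by (simp add: abs_mult sum_distrib_left sum_divide_distrib)
  also have "\<dots> \<le> 1" using assms(4) [OF x(2,3)] q by (simp add: q_def)
  finally have "(m / q) *\<^sub>R x \<in> l1_ball \<sigma>"
    unfolding l1_ball_def using x(3) by (simp add: coord_space_closed)
  moreover have "z = q *\<^sub>R ((m / q) *\<^sub>R x)" using q x(1) by (simp add: fun_eq_iff)
  ultimately show "z \<in> (*\<^sub>R) (sqrt (real (card \<sigma>))) ` l1_ball \<sigma>" unfolding q_def by blast
qed

text \<open>The threshold V = 256 m^2 n / t^2 serves both claims for the coordinates \<sigma> of a
  shattered set with more than V elements: V \<ge> m^2 n as t \<le> 1, and the l1 bound 2 / s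
  multiplied by m is sqrt V. If every shattered set had at most V elements, counting them would
  contradict \<open>entropy_contradiction\<close>.\<close>

lemma ex_coordinate_section:
  assumes n: "n \<ge> 1" and K: "convex_body n K" "symmetric K" "l2_ball n \<subseteq> K"
    and M: "M = mean_norm n K" and m: "m = M / 10 ^ 10 * ln (2 / M) powr (- 3 / 2)"
  shows "\<exists>\<sigma>\<subseteq>{1..n}. real (card \<sigma>) \<ge> m\<^sup>2 * n \<and>
    (*\<^sub>R) m ` (K \<inter> coord_space \<sigma>) \<subseteq> (*\<^sub>R) (sqrt (real (card \<sigma>))) ` l1_ball \<sigma>"
proof (cases "M = 0")
  \<comment> \<open>Here \<open>m = 0\<close>, and the empty set of coordinates will do: its l1 ball
    is \<open>{0}\<close>.\<close>
  case True
  have "(*\<^sub>R) m ` (K \<inter> coord_space {}) \<subseteq> (*\<^sub>R) (sqrt (real (card {}))) ` l1_ball {}"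
    by (auto simp: coord_space_def l1_ball_def image_iff fun_eq_iff)
  moreover have "real (card {}) \<ge> m\<^sup>2 * n" using True by (simp add: m)
  ultimately show ?thesis by blast
next
  case False
  then have M0: "0 < M" and M1: "M \<le> 1" using mean_norm_bounds [OF n K(3)] M by auto
  have K': "K \<subseteq> Rn n" "convex K" "compact K" "l2_ball n \<subseteq> K" using K by (auto simp: convex_body_def)
  define ell where "ell = ln (2 / M)"
  have ell: "ell > 0" unfolding ell_def using M0 M1 by (intro ln_gt_zero) (auto simp: field_simps)
  have m0: "m > 0" using M0 ell by (simp add: m ell_def)
  have "(ell powr (- 3 / 2))\<^sup>2 = ell powr (- 3)"
    using ell by (simp add: powr_powr flip: powr_numeral)
  also have "\<dots> = 1 / ell ^ 3" using ell by (simp add: powr_minus_divide flip: powr_numeral)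
  finally have m2: "m\<^sup>2 = (M / 10 ^ 10)\<^sup>2 / ell ^ 3"
    unfolding m ell_def [symmetric] power_mult_distrib by simp
  define r where "r = 768 / (M\<^sup>2 * sqrt n)"
  have r0: "r > 0" using M0 n by (simp add: r_def)
  obtain t A where t: "M / 8 \<le> t" "t \<le> 1" and A: "finite A" "A \<subseteq> truncate r ` polar n K"
    "separated n t A"
    "exp (M\<^sup>2 * n / (256000 * t\<^sup>2 * ell\<^sup>2)) \<le> card A"
    using ex_large_separated_set [OF n K' M M0 r_def] unfolding ell_def by blast
  have t0: "t > 0" using t M0 by linarith
  define s where "s = t / (8 * sqrt n)"
  have s0: "s > 0" using n t0 by (simp add: s_def)
  define Y where "Y f = (\<lambda>i. \<lfloor>f i / s\<rfloor>)" for f :: "nat \<Rightarrow> real"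
  have Ysep: "24 * real (card {1..n}) < (\<Sum>i\<in>{1..n}. (real_of_int (Y f i - Y g i))\<^sup>2)"
    if "f \<in> A" "g \<in> A" "f \<noteq> g" for f g
    unfolding Y_def using A(3) that
      by (intro discretization_separated [OF n t0 _ s_def]) (auto simp: separated_def)
  have inj: "inj_on Y A"
  proof (rule inj_onI, rule ccontr)
    fix f g assume "f \<in> A" "g \<in> A" "Y f = Y g" "f \<noteq> g"
    then show False using Ysep [of f g] by simp
  qed
  \<comment> \<open>This is \<open>r / s\<close>, the truncation height in grid steps. By truncation
    it does not involve \<open>n\<close>, and since t \<ge> M / 8 the number of levels is polynomial
    in 1 / M.\<close>
  define q where "q = 6144 / (M\<^sup>2 * t)"
  have "M\<^sup>2 * t \<le> 1" using M0 M1 t t0 by (intro mult_le_one) (auto simp: power_le_one)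
  then have q: "6144 \<le> q" using M0 t0 by (simp add: q_def pos_le_divide_eq)
  define H where "H = {- \<lceil>q\<rceil>..\<lceil>q\<rceil>}"
  have cH: "1 \<le> real (card H)" "real (card H) \<le> 3 * q"
    using q unfolding H_def by simp_all linarith+
  have "r / s = q" using n M0 t0 by (simp add: r_def s_def q_def field_simps)
  have range: "- \<lceil>q\<rceil> \<le> Y f i" "Y f i \<le> \<lceil>q\<rceil>" if f: "f \<in> A" for f i
  proof -
    obtain y where y: "f = truncate r y" using A(2) f by blast
    have "\<bar>f i\<bar> \<le> r" unfolding y truncate_def using r0 by (intro abs_clamp_real_le) simp
    then have "\<bar>f i / s\<bar> \<le> q" using s0 \<open>r / s = q\<close>
      by (metis abs_div_pos divide_right_mono less_imp_le)
    then show "- \<lceil>q\<rceil> \<le> Y f i" "Y f i \<le> \<lceil>q\<rceil>" unfolding Y_def by linarith+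
  qed
  have "card A > 0" using A(4) exp_gt_zero by (metis less_le_trans of_nat_0_less_iff)
  then have A0: "Y ` A \<noteq> {}" by auto
  define X where "X = {1..n} \<times> H"
  have X: "finite X" "real (card X) = n * real (card H)"
    by (simp_all add: X_def H_def card_cartesian_product)
  define V where "V = 256 * (M / 10 ^ 10)\<^sup>2 * n / (ell ^ 3 * t\<^sup>2)"
  have Vm: "V = m\<^sup>2 * n * (256 / t\<^sup>2)" by (simp add: V_def m2)
  have D: "n \<le> real (card X)" "real (card X) \<le> 3 * real n * (6144 / (M\<^sup>2 * t))"
  proof -
    have "real n * 1 \<le> n * real (card H)" using cH by (intro mult_left_mono) auto
    then show "n \<le> real (card X)" using X by simp
    have "n * real (card H) \<le> n * (3 * q)" using cH by (intro mult_left_mono) auto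
    then show "real (card X) \<le> 3 * real n * (6144 / (M\<^sup>2 * t))"
      unfolding X(2) q_def by (simp only: mult.assoc mult.left_commute)
  qed
  have numeric: "0 < V" "V \<le> card X"
    "2 * (V * ln (exp 1 * card X / V)) < M\<^sup>2 * n / (256000 * t\<^sup>2 * ell\<^sup>2)"
    using entropy_contradiction [OF n M0 M1 t V_def [unfolded ell_def] D]
      unfolding ell_def by blast+
  show ?thesis
  proof (rule ccontr)
    assume none: "\<not> ?thesis"
    have cardP: "real (card P) \<le> V" if P: "P \<subseteq> X" "shatters (Y ` A) P" for P
    proof -
      define \<sigma> where "\<sigma> = fst ` P"
      have \<sigma>: "\<sigma> \<subseteq> {1..n}" using P(1) by (auto simp: \<sigma>_def X_def)
      have c: "card \<sigma> = card P" unfolding \<sigma>_def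
        using shatters_inj_on_fst [OF P(2)] by (rule card_image)
      show ?thesis
      proof (rule ccontr)
        assume "\<not> ?thesis"
        then have big: "V < card \<sigma>" using c by simp
        have "256 / t\<^sup>2 \<ge> 1" using t t0
          by (simp add: pos_le_divide_eq power_le_one order_trans [of _ 1])
        then have "m\<^sup>2 * n * 1 \<le> V" unfolding Vm by (intro mult_left_mono) auto
        then have large: "real (card \<sigma>) \<ge> m\<^sup>2 * n" using big by simp
        have fin: "finite \<sigma>" using \<sigma> by (rule finite_subset) simp
        have ne: "\<sigma> \<noteq> {}" using big numeric(1) by auto
        have "(*\<^sub>R) m ` (K \<inter> coord_space \<sigma>) \<subseteq> (*\<^sub>R) (sqrt (real (card \<sigma>))) ` l1_ball \<sigma>"
        proof (rule scaled_section_subset [OF ne fin])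
          show "0 \<le> m" using m0 by simp
          fix x assume x: "x \<in> K" "x \<in> coord_space \<sigma>"
          have "(\<Sum>i\<in>\<sigma>. \<bar>x i\<bar>) \<le> 2 / s"
            unfolding \<sigma>_def using x P(2) \<sigma>
            by (intro l1_bound_of_shattered [OF K(2) s0 A(2)]) (auto simp: Y_def [abs_def] \<sigma>_def)
          then have "m * (\<Sum>i\<in>\<sigma>. \<bar>x i\<bar>) \<le> m * (2 / s)" using m0 by (intro mult_left_mono) auto
          also have "\<dots> = sqrt V"
          proof (rule real_sqrt_unique [symmetric])
            show "(m * (2 / s))\<^sup>2 = V" unfolding Vm s_def
              using n by (simp add: power_mult_distrib power_divide)
          qed (use m0 s0 in simp)
          also have "\<dots> \<le> sqrt (card \<sigma>)" using big by simp
          finally show "m * (\<Sum>i\<in>\<sigma>. \<bar>x i\<bar>) \<le> sqrt (card \<sigma>)" .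
        qed
        then show False using none \<sigma> large by blast
      qed
    qed
    have "sqrt (card (Y ` A)) \<le> card {P. P \<subseteq> {1..n} \<times> H \<and> shatters (Y ` A) P}"
    proof (rule sqrt_card_le_card_shattered)
      show "24 * real (card {1..n}) < (\<Sum>i\<in>{1..n}. (real_of_int (f i - g i))\<^sup>2)"
        if "f \<in> Y ` A" "g \<in> Y ` A" "f \<noteq> g" for f g
      proof -
        obtain f' g' where "f' \<in> A" "g' \<in> A" "f = Y f'" "g = Y g'"
          using \<open>f \<in> Y ` A\<close> \<open>g \<in> Y ` A\<close> by blast
        with \<open>f \<noteq> g\<close> Ysep [of f' g'] show ?thesis by auto
      qed
      show "j \<in> H" if "f \<in> Y ` A" "g \<in> Y ` A" "f i < j" "j < g i" for f g i j
      proof -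
        obtain f' g' where "f' \<in> A" "g' \<in> A" "f = Y f'" "g = Y g'"
          using \<open>f \<in> Y ` A\<close> \<open>g \<in> Y ` A\<close> by blast
        with that(3,4) range [of f' i] range [of g' i] show ?thesis by (simp add: H_def)
      qed
    qed (use A(1) A0 in \<open>auto simp: H_def\<close>)
    also have "\<dots> \<le> card {P. P \<subseteq> X \<and> real (card P) \<le> V}"
    proof (rule of_nat_mono, rule card_mono)
      show "finite {P. P \<subseteq> X \<and> real (card P) \<le> V}"
        by (rule finite_subset [of _ "Pow X"]) (use X(1) in auto)
      show "{P. P \<subseteq> {1..n} \<times> H \<and> shatters (Y ` A) P} \<subseteq> {P. P \<subseteq> X \<and> real (card P) \<le> V}"
        using cardP by (auto simp: X_def)
    qed
    also have "\<dots> \<le> (exp 1 * card X / V) powr V" using numeric X(1) by (intro card_subsets_le_powr)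
    finally have le: "sqrt (card A) \<le> (exp 1 * card X / V) powr V"
      using inj by (simp add: card_image)
    define b where "b = exp 1 * card X / V"
    have b: "b > 0" unfolding b_def using numeric by (intro divide_pos_pos mult_pos_pos) auto
    have "ln (sqrt (card A)) \<le> ln (b powr V)"
      using le \<open>card A > 0\<close> b unfolding b_def [symmetric] by (subst ln_le_cancel_iff) auto
    also have "\<dots> = V * ln (exp 1 * card X / V)"
      using b unfolding b_def [symmetric] by (simp add: ln_powr)
    finally have "ln (sqrt (card A)) \<le> V * ln (exp 1 * card X / V)" .
    then have "ln (card A) \<le> 2 * (V * ln (exp 1 * card X / V))"
      using \<open>card A > 0\<close> by (simp add: ln_sqrt)
    moreover have "M\<^sup>2 * n / (256000 * t\<^sup>2 * ell\<^sup>2) \<le> ln (card A)"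
      using A(4) \<open>card A > 0\<close> by (subst ln_ge_iff) auto
    ultimately show False using numeric(3) by linarith
  qed
qed

theorem theorem1p4:
  shows "\<exists>c::real. c > 0 \<and> (\<forall>n\<ge>1. \<forall>K. convex_body n K \<and> symmetric K \<and> l2_ball n \<subseteq> K \<longrightarrow>
    (let M = c * mean_norm n K * ln (2 / mean_norm n K) powr (- 3 / 2) in
      \<exists>\<sigma>\<subseteq>{1..n}. real (card \<sigma>) \<ge> M\<^sup>2 * real n \<and>
        (*\<^sub>R) M ` (K \<inter> coord_space \<sigma>) \<subseteq> (*\<^sub>R) (sqrt (real (card \<sigma>))) ` l1_ball \<sigma>))"
\<comment> \<open>The constant only has to be small enough for the estimates of
  \<open>entropy_contradiction\<close>, where it enters \<open>V\<close> through its square.\<close>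
proof (rule exI [of _ "1 / 10 ^ 10"], intro conjI allI impI)
  fix n K assume "1 \<le> n" "convex_body n K \<and> symmetric K \<and> l2_ball n \<subseteq> K"
  then show "let M = 1 / 10 ^ 10 * mean_norm n K * ln (2 / mean_norm n K) powr (- 3 / 2) in
      \<exists>\<sigma>\<subseteq>{1..n}. real (card \<sigma>) \<ge> M\<^sup>2 * real n \<and>
        (*\<^sub>R) M ` (K \<inter> coord_space \<sigma>) \<subseteq> (*\<^sub>R) (sqrt (real (card \<sigma>))) ` l1_ball \<sigma>"
    unfolding Let_def by (intro ex_coordinate_section [OF _ _ _ _ refl]) auto
qed simp

end
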